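(* There exist a $\sigma$-finite measure space $(\Omega,\mathcal{B},\mu)$ with $\mu(\Omega)=\infty$, a conservative, invertible, measure-preserving, ergodic transformation $T:\Omega\to\Omega$, a bounded measurable function (sampling function) $f:\Omega\to\mathbb{R}$, and $M>0$ such that the corresponding lower Lyapunov exponents satisfy $$\underline{L}^+(E)>\underline{L}^-(E)\quad\text{for all real }E>M,$$ and $$\underline{L}^+(E)<\underline{L}^-(E)\quad\text{for all real }E<-M.$$
   Context: A measurable transformation $T$ is: invertible if it is bijective and $T^{-1}$ is measurable; measure-preserving if $\mu(T^{-1}E)=\mu(E)$ for all $E\in\mathcal{B}$; ergodic if $T^{-1}E=E$ (with $E\in\mathcal{B}$) implies $\mu(E)=0$ or $\mu(\Omega\setminus E)=0$; conservative if there is no $W\in\mathcal{B}$ with $\mu(W)>0$ such that the sets $T^{-n}W$, $n\ge 0$, are pairwise disjoint. Transfer matrices: $A(E,\omega)=\begin{pmatrix}E-f(\omega)&-1\\1&0\end{pmatrix}$, and $A(E,n,\omega)=A(E,T^{n-1}\omega)\cdots A(E,\omega)$ for $n>0$, $A(E,0,\omega)=I$, $A(E,n,\omega)=A(E,T^{-|n|}\omega)^{-1}\cdots A(E,T^{-1}\omega)^{-1}$ for $n<0$. For each $E$, $\underline{L}^\pm(E)$ are the finite constants (which exist) such that $\liminf_{n\to\pm\infty}\frac1{|n|}\log\|A(E,n,\omega)\|=\underline{L}^\pm(E)$ for $\mu$-a.e. $\omega$. *)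

theory Defs
  imports "HOL-Analysis.Analysis"
begin

text \<open>The properties of a transformation \<^term>\<open>T\<close> are relative to \<^term>\<open>space M\<close>; values of
  \<^term>\<open>T\<close> outside \<^term>\<open>space M\<close> are irrelevant.\<close>

definition invertible_transformation :: "'a measure \<Rightarrow> ('a \<Rightarrow> 'a) \<Rightarrow> bool" where
  "invertible_transformation M T \<longleftrightarrow>
     T \<in> measurable M M \<and> bij_betw T (space M) (space M) \<and>
     inv_into (space M) T \<in> measurable M M"

definition measure_preserving_transformation :: "'a measure \<Rightarrow> ('a \<Rightarrow> 'a) \<Rightarrow> bool" where
  "measure_preserving_transformation M T \<longleftrightarrow>
     T \<in> measurable M M \<and>
     (\<forall>B\<in>sets M. emeasure M (T -` B \<inter> space M) = emeasure M B)"

definition ergodic_transformation :: "'a measure \<Rightarrow> ('a \<Rightarrow> 'a) \<Rightarrow> bool" where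
  "ergodic_transformation M T \<longleftrightarrow>
     T \<in> measurable M M \<and>
     (\<forall>B\<in>sets M. T -` B \<inter> space M = B \<longrightarrow> emeasure M B = 0 \<or> emeasure M (space M - B) = 0)"

definition conservative_transformation :: "'a measure \<Rightarrow> ('a \<Rightarrow> 'a) \<Rightarrow> bool" where
  "conservative_transformation M T \<longleftrightarrow>
     T \<in> measurable M M \<and>
     \<not> (\<exists>W\<in>sets M. emeasure M W > 0 \<and> disjoint_family (\<lambda>n::nat. (T ^^ n) -` W \<inter> space M))"

definition transfer_step :: "('a \<Rightarrow> real) \<Rightarrow> real \<Rightarrow> 'a \<Rightarrow> real^2^2" where
  "transfer_step f E \<omega> = vector [vector [E - f \<omega>, -1], vector [1, 0]]"

primrec transfer_forward ::
    "('a \<Rightarrow> 'a) \<Rightarrow> ('a \<Rightarrow> real) \<Rightarrow> real \<Rightarrow> nat \<Rightarrow> 'a \<Rightarrow> real^2^2" where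
  "transfer_forward T f E 0 \<omega> = mat 1"
| "transfer_forward T f E (Suc n) \<omega> =
     transfer_step f E ((T ^^ n) \<omega>) ** transfer_forward T f E n \<omega>"

text \<open>In \<^term>\<open>transfer_backward S f E n \<omega>\<close> the argument \<^term>\<open>S\<close> is the inverse of the
  transformation, so the product is
  $A(E,S^n\omega)^{-1} \cdots A(E,S\omega)^{-1}$.\<close>

primrec transfer_backward ::
    "('a \<Rightarrow> 'a) \<Rightarrow> ('a \<Rightarrow> real) \<Rightarrow> real \<Rightarrow> nat \<Rightarrow> 'a \<Rightarrow> real^2^2" where
  "transfer_backward S f E 0 \<omega> = mat 1"
| "transfer_backward S f E (Suc n) \<omega> =
     matrix_inv (transfer_step f E ((S ^^ Suc n) \<omega>)) ** transfer_backward S f E n \<omega>"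

definition transfer_matrix ::
    "'a measure \<Rightarrow> ('a \<Rightarrow> 'a) \<Rightarrow> ('a \<Rightarrow> real) \<Rightarrow> real \<Rightarrow> int \<Rightarrow> 'a \<Rightarrow> real^2^2" where
  "transfer_matrix M T f E n \<omega> =
     (if n \<ge> 0 then transfer_forward T f E (nat n) \<omega>
      else transfer_backward (inv_into (space M) T) f E (nat (- n)) \<omega>)"

text \<open>The operator norm is used, since \<^term>\<open>norm\<close> on \<^typ>\<open>real^2^2\<close> is the Frobenius norm.\<close>

definition lyapunov_quotient ::
    "'a measure \<Rightarrow> ('a \<Rightarrow> 'a) \<Rightarrow> ('a \<Rightarrow> real) \<Rightarrow> real \<Rightarrow> 'a \<Rightarrow> int \<Rightarrow> real" where
  "lyapunov_quotient M T f E \<omega> n =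
     1 / real_of_int \<bar>n\<bar> * ln (onorm (\<lambda>v. transfer_matrix M T f E n \<omega> *v v))"

text \<open>The lower Lyapunov exponents are given as relations: the number \<^term>\<open>L\<close> is the
  almost sure value of the lower limit as $n \to +\infty$, respectively $n \to -\infty$. It is
  unique whenever \<^term>\<open>M\<close> is not the null measure.\<close>

definition has_lower_lyapunov_plus ::
    "'a measure \<Rightarrow> ('a \<Rightarrow> 'a) \<Rightarrow> ('a \<Rightarrow> real) \<Rightarrow> real \<Rightarrow> real \<Rightarrow> bool" where
  "has_lower_lyapunov_plus M T f E L \<longleftrightarrow>
     (AE \<omega> in M. Liminf at_top (\<lambda>n. ereal (lyapunov_quotient M T f E \<omega> n)) = ereal L)"

definition has_lower_lyapunov_minus ::
    "'a measure \<Rightarrow> ('a \<Rightarrow> 'a) \<Rightarrow> ('a \<Rightarrow> real) \<Rightarrow> real \<Rightarrow> real \<Rightarrow> bool" where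
  "has_lower_lyapunov_minus M T f E L \<longleftrightarrow>
     (AE \<omega> in M. Liminf at_bot (\<lambda>n. ereal (lyapunov_quotient M T f E \<omega> n)) = ereal L)"

end

theory Submission
  imports Defs "HOL-Probability.Probability"
begin

text \<open>The transformation is a Kakutani skyscraper over the dyadic odometer. The carry stops
  at digit $k$ with probability $2^{-k-1}$, and the tower over such a point has height
  $2 \cdot 20^k$, so the total mass is infinite; the sampling function is $0$ on the lower and $1$
  on the upper half of each tower. Every forward orbit that starts on the ground floor meets zeros
  before ones, so its averages never exceed $1/2$; backwards it meets ones before zeros, so its
  averages never fall below $1/2$. The tower of height $2 \cdot 20^k$ is so much longer than
  everything an orbit meets before it that the forward averages are at most $1/10$
  infinitely often, and the backward averages at least $9/10$ infinitely often. For large $|E|$,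
  $\log \|A(E,n,\omega)\|$ is the sum of $\log |E - f|$ along the orbit up to an error of order
  $n / E^2$, whereas exchanging the values $0$ and $1$ of $f$ changes $\log |E - f|$ by about
  $1/|E|$. The sign of this change depends on the sign of $E$.\<close>

section \<open>Products of transfer matrices\<close>

text \<open>With a finite invariant measure, Kingman's theorem and det A = 1 force both exponents to
  coincide. Infinite mass is the resource: averages along orbits need not converge, and the two
  lower limits may see different frequencies of the value 1.

  Neither exponent is computed. Growth rates are invariant under the shift, hence almost everywhere
  constant by ergodicity. The ground floor has positive measure, so both constants can be read off
  at one ground-floor point whose digits take each value infinitely often. There a frequency bound
  valid at all times bounds one lower limit from below, and one valid at infinitely many times
  bounds the other from above.

  Let y be the smaller value of |E - f|. The thresholds 1/2 and 1/10 gain 4/10 of ln(y + 1) - ln y,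
  which has order 1/y and beats the errors of order 1/y^2 once y is at least 99; this is the origin
  of the bound 100 on |E|.

  The theorem quantifies over measures on \<open>real\<close>, since HOL cannot bind a type
  existentially, so the finished system is moved along an injection into the reals.\<close>

definition schroedinger_step :: "real \<Rightarrow> real^2^2" where
  "schroedinger_step x = vector [vector [x, -1], vector [1, 0]]"

text \<open>An arbitrary real sequence replaces the orbit: forward and backward cocycles become the
  same kind of product over different sequences, so all norm estimates are made once.\<close>

primrec schroedinger_product :: "(nat \<Rightarrow> real) \<Rightarrow> nat \<Rightarrow> real^2^2" where
  "schroedinger_product x 0 = mat 1"
| "schroedinger_product x (Suc n) = schroedinger_step (x n) ** schroedinger_product x n"

definition opnorm :: "real^2^2 \<Rightarrow> real" where
  "opnorm A = onorm (\<lambda>v. A *v v)"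

definition growth_rate :: "(nat \<Rightarrow> real) \<Rightarrow> ereal" where
  "growth_rate x = liminf (\<lambda>n. ereal (1 / real n * ln (opnorm (schroedinger_product x n))))"

text \<open>Conjugation by this coordinate exchange turns a step into its inverse. Being an
  isometric involution, it preserves the operator norm, so backward products reduce to forward
  ones.\<close>

definition swap2 :: "real^2^2" where
  "swap2 = vector [vector [0, 1], vector [1, 0]]"

lemma matrix2_eqI:
  fixes A B :: "real^2^2"
  assumes "A$1$1 = B$1$1" "A$1$2 = B$1$2" "A$2$1 = B$2$1" "A$2$2 = B$2$2"
  shows "A = B"
  using assms by (simp add: vec_eq_iff forall_2)

lemma matrix_mult_2:
  fixes A B :: "real^2^2"
  shows "(A ** B)$i$j = A$i$1 * B$1$j + A$i$2 * B$2$j"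
  by (simp add: matrix_matrix_mult_def sum_2)

lemma matrix_vector_2:
  fixes A :: "real^2^2"
  shows "(A *v w)$i = A$i$1 * w$1 + A$i$2 * w$2"
  by (simp add: matrix_vector_mult_def sum_2)

lemma norm_vec2: "norm (w::real^2) = sqrt ((w$1)\<^sup>2 + (w$2)\<^sup>2)"
  by (simp add: norm_vec_def L2_set_def sum_2)

lemma opnorm_mult: "opnorm (A ** B) \<le> opnorm A * opnorm B"
  using onorm_compose[OF matrix_vector_mul_bounded_linear matrix_vector_mul_bounded_linear, of A B]
  by (simp add: opnorm_def comp_def matrix_vector_mul_assoc)

lemma opnorm_mat_1: "opnorm (mat 1) = 1"
  by (simp add: opnorm_def onorm_id)

lemma opnorm_nonneg: "0 \<le> opnorm A"
  unfolding opnorm_def by (rule onorm_pos_le[OF matrix_vector_mul_bounded_linear])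

lemma norm_mult_le_opnorm: "norm (A *v w) \<le> opnorm A * norm w"
  unfolding opnorm_def by (rule onorm[OF matrix_vector_mul_bounded_linear])

lemma swap2_swap2: "swap2 ** swap2 = mat 1"
  by (rule matrix2_eqI) (simp_all add: matrix_mult_2 swap2_def mat_def)

lemma opnorm_swap2: "opnorm swap2 \<le> 1"
  unfolding opnorm_def
  by (rule onorm_bound) (simp_all add: norm_vec2 matrix_vector_2 swap2_def add.commute)

lemma opnorm_conj_swap2: "opnorm (swap2 ** A ** swap2) = opnorm A"
proof -
  \<comment> \<open>One inequality suffices, because conjugating twice restores the matrix.\<close>
  have *: "opnorm (swap2 ** B ** swap2) \<le> opnorm B" for B
  proof -
    have "opnorm (swap2 ** B ** swap2) \<le> opnorm (swap2 ** B) * opnorm swap2"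
      by (rule opnorm_mult)
    also have "\<dots> \<le> opnorm (swap2 ** B) * 1"
      by (intro mult_left_mono opnorm_swap2 opnorm_nonneg)
    also have "\<dots> \<le> opnorm swap2 * opnorm B"
      using opnorm_mult by simp
    also have "\<dots> \<le> 1 * opnorm B"
      by (intro mult_right_mono opnorm_swap2 opnorm_nonneg)
    finally show ?thesis by simp
  qed
  have "swap2 ** (swap2 ** A ** swap2) ** swap2 = (swap2 ** swap2) ** A ** (swap2 ** swap2)"
    by (simp only: matrix_mul_assoc)
  then have "swap2 ** (swap2 ** A ** swap2) ** swap2 = A"
    by (simp add: swap2_swap2)
  then show ?thesis using *[of A] *[of "swap2 ** A ** swap2"] by simp
qed

lemma opnorm_step_le: "opnorm (schroedinger_step x) \<le> sqrt (x\<^sup>2 + 2)"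
  unfolding opnorm_def
proof (rule onorm_bound)
  fix w :: "real^2"
  \<comment> \<open>The extra squares come from the image of (w$2, -w$1), which is orthogonal to w
    and of equal length. Over such a pair the squared image norms add up to |w|^2 times the squared
    Frobenius norm x^2 + 2.\<close>
  have "(x * w$1 - w$2)\<^sup>2 + (w$1)\<^sup>2 + (x * w$2 + w$1)\<^sup>2 + (w$2)\<^sup>2
      = (x\<^sup>2 + 2) * ((w$1)\<^sup>2 + (w$2)\<^sup>2)"
    by (simp add: power2_eq_square algebra_simps)
  then have "(x * w$1 - w$2)\<^sup>2 + (w$1)\<^sup>2 \<le> (x\<^sup>2 + 2) * ((w$1)\<^sup>2 + (w$2)\<^sup>2)"
    by (smt (verit) zero_le_power2)
  then show "norm (schroedinger_step x *v w) \<le> sqrt (x\<^sup>2 + 2) * norm w"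
    by (simp add: norm_vec2 matrix_vector_2 schroedinger_step_def flip: real_sqrt_mult)
qed simp

lemma step_inverse_left:
  "(swap2 ** schroedinger_step x ** swap2) ** schroedinger_step x = mat 1"
  by (rule matrix2_eqI) (simp_all add: matrix_mult_2 swap2_def schroedinger_step_def mat_def)

lemma step_inverse_right:
  "schroedinger_step x ** (swap2 ** schroedinger_step x ** swap2) = mat 1"
  by (rule matrix2_eqI) (simp_all add: matrix_mult_2 swap2_def schroedinger_step_def mat_def)

lemma matrix_inv_step:
  "matrix_inv (schroedinger_step x) = swap2 ** schroedinger_step x ** swap2"
proof -
  have "invertible (schroedinger_step x)"
    unfolding invertible_def using step_inverse_left step_inverse_right by blast
  then have "matrix_inv (schroedinger_step x) ** schroedinger_step x = mat 1"
    unfolding matrix_inv_def invertible_def by (rule someI2_ex) blast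
  moreover have "matrix_inv (schroedinger_step x) =
      matrix_inv (schroedinger_step x) ** schroedinger_step x
      ** (swap2 ** schroedinger_step x ** swap2)"
    by (metis matrix_mul_assoc matrix_mul_rid step_inverse_right)
  ultimately show ?thesis
    by (simp only: matrix_mul_lid)
qed

lemma transfer_forward_eq:
  "transfer_forward T f E n \<omega> = schroedinger_product (\<lambda>k. E - f ((T ^^ k) \<omega>)) n"
  by (induction n) (simp_all add: transfer_step_def schroedinger_step_def)

text \<open>The swaps between neighbouring factors cancel. The sequence starts at
  \<open>S \<omega>\<close> instead of \<open>\<omega>\<close>, hence \<open>Suc k\<close>.\<close>

lemma transfer_backward_eq:
  "transfer_backward S f E n \<omega>
     = swap2 ** schroedinger_product (\<lambda>k. E - f ((S ^^ Suc k) \<omega>)) n ** swap2"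
proof (induction n)
  case (Suc n)
  let ?P = "schroedinger_product (\<lambda>k. E - f ((S ^^ Suc k) \<omega>)) n"
  let ?A = "schroedinger_step (E - f ((S ^^ Suc n) \<omega>))"
  have "transfer_backward S f E (Suc n) \<omega> = (swap2 ** ?A ** swap2) ** (swap2 ** ?P ** swap2)"
    using Suc.IH matrix_inv_step by (simp add: transfer_step_def schroedinger_step_def)
  also have "\<dots> = swap2 ** ?A ** (swap2 ** swap2) ** ?P ** swap2"
    by (simp only: matrix_mul_assoc)
  finally show ?case by (simp add: swap2_swap2 matrix_mul_assoc)
qed (simp add: swap2_swap2)

section \<open>Limits over the integers as limits of sequences\<close>

lemma at_top_int_filtermap: "(at_top :: int filter) = filtermap int at_top"
proof (rule filter_eqI)
  fix P :: "int \<Rightarrow> bool"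
  show "eventually P at_top = eventually P (filtermap int at_top)"
    unfolding eventually_filtermap eventually_at_top_linorder
    by (metis nat_0_le nat_le_iff of_nat_0_le_iff order_trans nle_le of_nat_le_iff zle_int)
qed

lemma at_bot_int_filtermap: "(at_bot :: int filter) = filtermap (\<lambda>n. - int n) at_top"
  by (simp add: at_bot_mirror at_top_int_filtermap filtermap_filtermap)

lemma Liminf_lyapunov_quotient_at_top:
  "Liminf at_top (\<lambda>n. ereal (lyapunov_quotient M T f E \<omega> n))
     = growth_rate (\<lambda>k. E - f ((T ^^ k) \<omega>))"
  unfolding at_top_int_filtermap growth_rate_def
  by (subst Liminf_filtermap_eq)
     (auto simp: inj_def lyapunov_quotient_def transfer_matrix_def transfer_forward_eq opnorm_def)

lemma Liminf_lyapunov_quotient_at_bot: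
  "Liminf at_bot (\<lambda>n. ereal (lyapunov_quotient M T f E \<omega> n))
     = growth_rate (\<lambda>k. E - f ((inv_into (space M) T ^^ Suc k) \<omega>))"
proof -
  have "transfer_matrix M T f E (- int n) \<omega> = transfer_backward (inv_into (space M) T) f E n \<omega>" for n
    by (cases "n = 0") (auto simp: transfer_matrix_def)
  then have "lyapunov_quotient M T f E \<omega> (- int n) = 1 / real n *
      ln (opnorm (schroedinger_product (\<lambda>k. E - f ((inv_into (space M) T ^^ Suc k) \<omega>)) n))" for n
    unfolding lyapunov_quotient_def
    by (simp add: transfer_backward_eq opnorm_conj_swap2 flip: opnorm_def del: funpow.simps)
  then show ?thesis
    unfolding at_bot_int_filtermap growth_rate_def
    by (subst Liminf_filtermap_eq) (auto simp: inj_def simp del: funpow.simps)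
qed

text \<open>The recursion appends factors on the left; removing the first orbit point concerns the
  factor on the far right.\<close>

lemma product_Suc_shift:
  "schroedinger_product x (Suc n)
     = schroedinger_product (\<lambda>k. x (Suc k)) n ** schroedinger_step (x 0)"
  by (induction n) (simp_all add: matrix_mul_assoc)

text \<open>The inverse of a step has the same norm as the step, so a step on either side changes a
  norm by a factor between 1/C and C.\<close>

lemma opnorm_step_bounds:
  assumes "sqrt (t\<^sup>2 + 2) \<le> C"
  shows "opnorm (schroedinger_step t ** A) \<le> C * opnorm A"
    and "opnorm A \<le> C * opnorm (schroedinger_step t ** A)"
    and "opnorm (A ** schroedinger_step t) \<le> C * opnorm A"
    and "opnorm A \<le> C * opnorm (A ** schroedinger_step t)"
proof -
  define Q where "Q = swap2 ** schroedinger_step t ** swap2"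
  have nS: "opnorm (schroedinger_step t) \<le> C"
    using opnorm_step_le assms order_trans by blast
  then have nQ: "opnorm Q \<le> C"
    by (simp add: Q_def opnorm_conj_swap2)
  have left: "opnorm (B ** D) \<le> C * opnorm D" if "opnorm B \<le> C" for B D
    using opnorm_mult[of B D] mult_right_mono[OF that opnorm_nonneg[of D]] by linarith
  have right: "opnorm (D ** B) \<le> C * opnorm D" if "opnorm B \<le> C" for B D
    using opnorm_mult[of D B] mult_right_mono[OF that opnorm_nonneg[of D]]
    by (simp add: mult.commute)
  show "opnorm (schroedinger_step t ** A) \<le> C * opnorm A" by (rule left[OF nS])
  show "opnorm (A ** schroedinger_step t) \<le> C * opnorm A" by (rule right[OF nS])
  have "Q ** (schroedinger_step t ** A) = A"
    by (simp only: matrix_mul_assoc Q_def step_inverse_left matrix_mul_lid)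
  then show "opnorm A \<le> C * opnorm (schroedinger_step t ** A)"
    using left[OF nQ, of "schroedinger_step t ** A"] by simp
  have "A ** schroedinger_step t ** Q = A"
    by (metis Q_def step_inverse_right matrix_mul_rid matrix_mul_assoc)
  then show "opnorm A \<le> C * opnorm (A ** schroedinger_step t)"
    using right[OF nQ, of "A ** schroedinger_step t"] by simp
qed

context
  fixes x :: "nat \<Rightarrow> real" and C :: real
  assumes bnd: "\<And>k. sqrt ((x k)\<^sup>2 + 2) \<le> C"
begin

private lemma C_pos: "1 \<le> C"
  using bnd[of 0] by (meson order_trans real_sqrt_ge_one le_add_same_cancel2 one_le_numeral
      add_increasing zero_le_power2)

lemma product_bounds:
  "opnorm (schroedinger_product x n) > 0 \<and>
   \<bar>ln (opnorm (schroedinger_product x n))\<bar> \<le> real n * ln C"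
proof (induction n)
  case (Suc n)
  let ?a = "opnorm (schroedinger_product x n)" and ?b = "opnorm (schroedinger_product x (Suc n))"
  have 1: "?b \<le> C * ?a" "?a \<le> C * ?b"
    using opnorm_step_bounds(1,2)[OF bnd[of n]] by simp_all
  with Suc C_pos have b: "?b > 0"
    by (smt (verit) mult_nonneg_nonpos)
  have "ln ?b \<le> ln C + ln ?a" "ln ?a \<le> ln C + ln ?b"
    using 1 b Suc C_pos by (simp_all flip: ln_mult_pos)
  with Suc have "\<bar>ln ?b\<bar> \<le> ln C + real n * ln C" by linarith
  then show ?case using b by (simp add: algebra_simps)
qed (simp add: opnorm_mat_1)

lemma growth_rate_finite: "- ereal (ln C) \<le> growth_rate x" "growth_rate x \<le> ereal (ln C)"
proof -
  have *: "\<bar>1 / real n * ln (opnorm (schroedinger_product x n))\<bar> \<le> ln C" for n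
    using product_bounds[of n] C_pos by (cases "n = 0") (auto simp: field_simps abs_mult)
  show "- ereal (ln C) \<le> growth_rate x"
    unfolding growth_rate_def
  proof (intro Liminf_bounded always_eventually allI)
    fix n show "- ereal (ln C) \<le> ereal (1 / real n * ln (opnorm (schroedinger_product x n)))"
      using abs_le_D2[OF *[of n]] by (simp only: uminus_ereal.simps ereal_less_eq minus_le_iff)
  qed
  have "growth_rate x \<le> limsup (\<lambda>n. ereal (1 / real n * ln (opnorm (schroedinger_product x n))))"
    unfolding growth_rate_def by (rule Liminf_le_Limsup) simp
  also have "\<dots> \<le> ereal (ln C)"
  proof (intro Limsup_bounded always_eventually allI)
    fix n show "ereal (1 / real n * ln (opnorm (schroedinger_product x n))) \<le> ereal (ln C)"
      using abs_le_D1[OF *[of n]] by (simp only: ereal_less_eq)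
  qed
  finally show "growth_rate x \<le> ereal (ln C)" .
qed

end

text \<open>Dropping the first factor moves the log-norm by at most \<open>ln C\<close>. Replacing
  1/n by 1/(n + 1) moves the quotient by at most \<open>ln C\<close> / (n + 1), because the log-norm
  grows at most linearly. Both effects vanish in the limit.\<close>

lemma growth_rate_shift:
  fixes x :: "nat \<Rightarrow> real"
  assumes bnd: "\<And>k. sqrt ((x k)\<^sup>2 + 2) \<le> C"
  shows "growth_rate (\<lambda>k. x (Suc k)) = growth_rate x"
proof -
  define a b where "a n = ln (opnorm (schroedinger_product x n))"
    and "b n = ln (opnorm (schroedinger_product (\<lambda>k. x (Suc k)) n))" for n
  define K where "K = ln C"
  have "1 \<le> sqrt ((x 0)\<^sup>2 + 2)" by simp
  with bnd[of 0] have C: "1 \<le> C" by linarith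
  have ab: "\<bar>a (Suc n) - b n\<bar> \<le> K" for n
  proof -
    let ?p = "opnorm (schroedinger_product x (Suc n))"
      and ?q = "opnorm (schroedinger_product (\<lambda>k. x (Suc k)) n)"
    have p: "?p > 0" using product_bounds[of x C] bnd by blast
    have q: "?q > 0" using product_bounds[of "\<lambda>k. x (Suc k)" C] bnd by blast
    have "?p \<le> C * ?q" "?q \<le> C * ?p"
      using opnorm_step_bounds(3,4)[OF bnd[of 0]] by (simp_all only: product_Suc_shift)
    then have "ln ?p \<le> ln C + ln ?q" "ln ?q \<le> ln C + ln ?p"
      using p q C by (simp_all flip: ln_mult_pos)
    then show ?thesis by (simp add: a_def b_def K_def)
  qed
  have b: "\<bar>b n\<bar> \<le> real n * K" for n
    using product_bounds[of "\<lambda>k. x (Suc k)" C] bnd by (simp add: b_def K_def)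
  define d where "d n = 1 / real n * b n - 1 / real (Suc n) * a (Suc n)" for n
  have d: "\<bar>d n\<bar> \<le> 2 * K * (1 / real (Suc n))" for n
  proof (cases "n = 0")
    case True
    then show ?thesis using ab[of 0] b[of 0] by (simp add: d_def)
  next
    case False
    have e: "1 / real n * b n = b n / real (Suc n) + b n / real n / real (Suc n)"
      using False by (simp add: divide_simps) (simp add: algebra_simps)
    have "d n = (b n - a (Suc n)) / real (Suc n) + b n / real n / real (Suc n)"
      unfolding d_def e by (simp add: diff_divide_distrib)
    also have "\<bar>\<dots>\<bar> \<le> \<bar>a (Suc n) - b n\<bar> / real (Suc n) + \<bar>b n\<bar> / real n / real (Suc n)"
      by (rule order_trans[OF abs_triangle_ineq]) (simp add: abs_minus_commute)
    also have "\<dots> \<le> K / real (Suc n) + K / real (Suc n)"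
      using ab b[of n] False by (intro add_mono divide_right_mono) (auto simp: field_simps)
    finally show ?thesis by simp
  qed
  have "(\<lambda>n. 2 * K * (1 / real (Suc n))) \<longlonglongrightarrow> 2 * K * 0"
    by (intro tendsto_intros LIMSEQ_Suc[OF lim_1_over_n])
  then have "d \<longlonglongrightarrow> 0"
    using d by (intro Lim_null_comparison[of d]) auto
  then have dlim: "(\<lambda>n. ereal (d n)) \<longlonglongrightarrow> ereal 0" by simp
  have "growth_rate (\<lambda>k. x (Suc k)) = liminf (\<lambda>n. ereal (d n) + ereal (1 / real (Suc n) * a (Suc n)))"
    unfolding growth_rate_def by (simp add: d_def b_def)
  also have "\<dots> = ereal 0 + liminf (\<lambda>n. ereal (1 / real (Suc n) * a (Suc n)))"
    by (rule ereal_liminf_lim_add[OF dlim]) simp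
  also have "\<dots> = liminf (\<lambda>n. ereal (1 / real n * a n))"
    using liminf_shift[of "\<lambda>n. ereal (1 / real n * a n)"] by simp
  finally show ?thesis by (simp add: growth_rate_def a_def)
qed

section \<open>Log-norms against sums of logarithms\<close>

lemma ln_opnorm_product_le:
  assumes bnd: "\<And>k. sqrt ((x k)\<^sup>2 + 2) \<le> C"
  shows "ln (opnorm (schroedinger_product x n)) \<le> (\<Sum>k<n. ln ((x k)\<^sup>2 + 2) / 2)"
proof (induction n)
  case (Suc n)
  let ?a = "opnorm (schroedinger_product x n)" and ?b = "opnorm (schroedinger_product x (Suc n))"
  have pos: "?a > 0" "?b > 0" using product_bounds[of x C] bnd by blast+
  have sq: "sqrt ((x n)\<^sup>2 + 2) > 0"
    by (simp add: add_nonneg_pos)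
  have "?b \<le> sqrt ((x n)\<^sup>2 + 2) * ?a"
    using opnorm_step_bounds(1)[OF order_refl] by simp
  then have "ln ?b \<le> ln (sqrt ((x n)\<^sup>2 + 2)) + ln ?a"
    using pos sq by (simp del: schroedinger_product.simps flip: ln_mult_pos)
  then show ?case using Suc by (simp add: ln_sqrt add_nonneg_pos)
qed (simp add: opnorm_mat_1)

text \<open>For the first column (u, w) of the product the cone |w| \<le> \<delta> |u| is preserved:
  the new w is the old u, and the new u has size at least (|x| - \<delta>) |u|, which is at least (m
  - 1) |u| = |u| / \<delta>. So every step multiplies |u| by at least |x| - \<delta>.\<close>

lemma ln_opnorm_product_ge:
  assumes m: "2 \<le> m" and x: "\<And>k. m \<le> \<bar>x k\<bar>"
  shows "(\<Sum>k<n. ln (\<bar>x k\<bar> - 1 / (m - 1))) \<le> ln (opnorm (schroedinger_product x n))"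
proof -
  define \<delta> where "\<delta> = 1 / (m - 1)"
  have \<delta>: "0 < \<delta>" "\<delta> \<le> 1" using m by (auto simp: \<delta>_def)
  let ?u = "\<lambda>n. schroedinger_product x n $ 1 $ 1" and ?w = "\<lambda>n. schroedinger_product x n $ 2 $ 1"
  have "?u n \<noteq> 0 \<and> \<bar>?w n\<bar> \<le> \<delta> * \<bar>?u n\<bar> \<and> (\<Sum>k<n. ln (\<bar>x k\<bar> - \<delta>)) \<le> ln \<bar>?u n\<bar>"
  proof (induction n)
    case (Suc n)
    have u: "?u (Suc n) = x n * ?u n - ?w n" and w: "?w (Suc n) = ?u n"
      by (simp_all add: matrix_mult_2 schroedinger_step_def)
    have "(\<bar>x n\<bar> - \<delta>) * \<bar>?u n\<bar> = \<bar>x n * ?u n\<bar> - \<delta> * \<bar>?u n\<bar>"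
      by (simp add: algebra_simps abs_mult)
    also have "\<dots> \<le> \<bar>?u (Suc n)\<bar>" unfolding u using Suc by linarith
    finally have ge: "(\<bar>x n\<bar> - \<delta>) * \<bar>?u n\<bar> \<le> \<bar>?u (Suc n)\<bar>" .
    have xn: "m - 1 \<le> \<bar>x n\<bar> - \<delta>" using x[of n] \<delta> by linarith
    then have xpos: "\<bar>x n\<bar> - \<delta> > 0" using m by linarith
    with ge Suc have pos: "\<bar>?u (Suc n)\<bar> > 0"
      by (smt (verit) mult_pos_pos zero_less_abs_iff)
    have "\<bar>?u n\<bar> = \<delta> * ((m - 1) * \<bar>?u n\<bar>)" using m by (simp add: \<delta>_def)
    also have "\<dots> \<le> \<delta> * ((\<bar>x n\<bar> - \<delta>) * \<bar>?u n\<bar>)"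
      using xn \<delta> by (intro mult_left_mono mult_right_mono) auto
    also have "\<dots> \<le> \<delta> * \<bar>?u (Suc n)\<bar>" using ge \<delta> by (intro mult_left_mono) auto
    finally have 2: "\<bar>?w (Suc n)\<bar> \<le> \<delta> * \<bar>?u (Suc n)\<bar>" by (simp only: w)
    have "ln (\<bar>x n\<bar> - \<delta>) + ln \<bar>?u n\<bar> = ln ((\<bar>x n\<bar> - \<delta>) * \<bar>?u n\<bar>)"
      using xpos Suc by (simp add: ln_mult_pos)
    also have "\<dots> \<le> ln \<bar>?u (Suc n)\<bar>"
      using ge xpos Suc pos by (subst ln_le_cancel_iff) (auto simp del: schroedinger_product.simps)
    finally show ?case using Suc 2 pos by (simp del: schroedinger_product.simps)
  qed (use \<delta> in \<open>simp add: mat_def\<close>)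
  moreover have "\<bar>?u n\<bar> \<le> opnorm (schroedinger_product x n)"
  proof -
    let ?e = "vector [1, 0] :: real^2" and ?A = "schroedinger_product x n"
    have "\<bar>?A $ 1 $ 1\<bar> = \<bar>(?A *v ?e) $ 1\<bar>" by (simp add: matrix_vector_2)
    also have "\<dots> \<le> norm (?A *v ?e)" by (rule component_le_norm_cart)
    also have "\<dots> \<le> opnorm ?A * norm ?e" by (rule norm_mult_le_opnorm)
    also have "norm ?e = 1" by (simp add: norm_vec2)
    finally show ?thesis by simp
  qed
  ultimately show ?thesis unfolding \<delta>_def
    by (smt (verit) ln_le_cancel_iff zero_less_abs_iff)
qed

text \<open>These compare $\log \|A\|$ with $\sum \log |x_k|$ for $|x_k| \in \{y, y + 1\}$: the second
  entry of the solution perturbs each factor by at most $1/(y-1)$ from below, and a single step has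
  norm at most $\sqrt{x^2 + 2}$. The weights are the extreme frequencies of the two values.\<close>

definition rate_lower :: "real \<Rightarrow> real" where
  "rate_lower y = (ln (y - 1 / (y - 1)) + ln (y + 1 - 1 / (y - 1))) / 2"

definition rate_upper :: "real \<Rightarrow> real" where
  "rate_upper y = 9 / 10 * (ln (y\<^sup>2 + 2) / 2) + 1 / 10 * (ln ((y + 1)\<^sup>2 + 2) / 2)"

text \<open>The sequence \<open>t\<close> marks the larger of the two moduli: it will be f for
  negative E and 1 - f for positive E, so one statement serves both signs. As \<open>t\<close> takes
  only the values 0 and 1, the logarithm is affine in it and only the number of ones
  matters.\<close>

lemma growth_rate_ge:
  assumes y: "2 \<le> y" and t: "\<And>k. t k \<in> {0, 1}" and x: "\<And>k. \<bar>x k\<bar> = y + t k"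
    and half: "\<And>n. real n / 2 \<le> (\<Sum>k<n. t k)"
  shows "ereal (rate_lower y) \<le> growth_rate x"
proof -
  define \<delta> where "\<delta> = 1 / (y - 1)"
  have \<delta>: "0 < \<delta>" "\<delta> \<le> 1" using y by (auto simp: \<delta>_def)
  let ?c0 = "ln (y - \<delta>)" and ?c1 = "ln (y + 1 - \<delta>)"
  have c: "?c0 \<le> ?c1" using \<delta> y by (subst ln_le_cancel_iff) auto
  have "rate_lower y \<le> 1 / real n * ln (opnorm (schroedinger_product x n))" if n: "n > 0" for n
  proof -
    have "real n * rate_lower y = real n * ?c0 + (?c1 - ?c0) * (real n / 2)"
      by (simp add: rate_lower_def \<delta>_def field_simps)
    also have "\<dots> \<le> real n * ?c0 + (?c1 - ?c0) * (\<Sum>k<n. t k)"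
      using half c by (intro add_left_mono mult_left_mono) auto
    also have "\<dots> = (\<Sum>k<n. ?c0 + (?c1 - ?c0) * t k)"
      by (simp add: sum.distrib sum_distrib_left)
    also have "\<dots> = (\<Sum>k<n. ln (\<bar>x k\<bar> - \<delta>))"
    proof (rule sum.cong[OF refl])
      fix k show "?c0 + (?c1 - ?c0) * t k = ln (\<bar>x k\<bar> - \<delta>)"
        using t[of k] by (auto simp: x)
    qed
    also have "\<dots> \<le> ln (opnorm (schroedinger_product x n))"
      unfolding \<delta>_def using y t by (intro ln_opnorm_product_ge) (auto simp: x, smt (verit))
    finally show ?thesis using n by (simp add: field_simps)
  qed
  then show ?thesis unfolding growth_rate_def
    by (intro Liminf_bounded) (auto intro: eventually_mono[OF eventually_gt_at_top[of 0]])
qed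

text \<open>Infinitely many good times suffice for an upper bound on a lower limit: if the lower
  limit exceeded the rate, so would all late quotients, including one at a good time.\<close>

lemma growth_rate_le:
  assumes y: "2 \<le> y" and t: "\<And>k. t k \<in> {0, 1}" and x: "\<And>k. \<bar>x k\<bar> = y + t k"
    and tenth: "\<exists>\<^sub>F n in sequentially. (\<Sum>k<n. t k) \<le> real n / 10"
  shows "growth_rate x \<le> ereal (rate_upper y)"
proof (rule ccontr)
  assume "\<not> ?thesis"
  then have "ereal (rate_upper y) < growth_rate x" by simp
  then have "\<forall>\<^sub>F n in sequentially.
      rate_upper y < 1 / real n * ln (opnorm (schroedinger_product x n))"
    unfolding growth_rate_def by (auto dest: less_LiminfD)
  then have "\<exists>\<^sub>F n in sequentially.
      (rate_upper y < 1 / real n * ln (opnorm (schroedinger_product x n)) \<and> n > 0) \<and>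
      (\<Sum>k<n. t k) \<le> real n / 10"
    by (intro frequently_eventually_conj[OF tenth] eventually_conj eventually_gt_at_top)
  then obtain n where tn: "(\<Sum>k<n. t k) \<le> real n / 10" and n: "n > 0"
    and less: "rate_upper y < 1 / real n * ln (opnorm (schroedinger_product x n))"
    using frequently_ex by blast
  let ?d0 = "ln (y\<^sup>2 + 2) / 2" and ?d1 = "ln ((y + 1)\<^sup>2 + 2) / 2"
  have d: "?d0 \<le> ?d1" using y
    by (intro divide_right_mono) (auto simp: power2_eq_square algebra_simps add_nonneg_pos)
  have "sqrt ((x k)\<^sup>2 + 2) \<le> sqrt ((y + 1)\<^sup>2 + 2)" for k
  proof -
    have "\<bar>x k\<bar>\<^sup>2 \<le> (y + 1)\<^sup>2" using y t[of k] x[of k] by (intro power_mono) auto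
    then show ?thesis by simp
  qed
  then have "ln (opnorm (schroedinger_product x n)) \<le> (\<Sum>k<n. ln ((x k)\<^sup>2 + 2) / 2)"
    by (rule ln_opnorm_product_le)
  also have "\<dots> = (\<Sum>k<n. ?d0 + (?d1 - ?d0) * t k)"
  proof (rule sum.cong[OF refl])
    fix k show "ln ((x k)\<^sup>2 + 2) / 2 = ?d0 + (?d1 - ?d0) * t k"
      using t[of k] x[of k] power2_abs[of "x k"] by auto
  qed
  also have "\<dots> = real n * ?d0 + (?d1 - ?d0) * (\<Sum>k<n. t k)"
    by (simp add: sum.distrib sum_distrib_left)
  also have "\<dots> \<le> real n * ?d0 + (?d1 - ?d0) * (real n / 10)"
    using tn d by (intro add_left_mono mult_left_mono) auto
  also have "\<dots> = real n * rate_upper y"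
    by (simp add: rate_upper_def field_simps)
  finally show False using less n by (simp add: field_simps)
qed

text \<open>The weights of ln(y + 1) are 1/2 and 1/10, so the main terms gain 4/10 of ln(y + 1) - ln
  y, at least 4/10 of q. The corrections cost each rate at most \<delta>^2, and \<delta>^2 is at
  most 0.0121 q.\<close>

lemma rate_upper_less_rate_lower:
  assumes y: "99 \<le> y"
  shows "rate_upper y < rate_lower y"
proof -
  define \<delta> where "\<delta> = 1 / (y - 1)"
  have \<delta>: "0 < \<delta>" "\<delta> \<le> 1" using y by (auto simp: \<delta>_def)
  define q where "q = 1 / (y + 1)"
  have q: "0 < q" "q \<le> 1 / 100" using y by (auto simp: q_def field_simps)
  have \<delta>q: "\<delta> \<le> 11 / 10 * q" using y by (auto simp: \<delta>_def q_def field_simps)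
  have c: "ln z - ln (z - \<delta>) \<le> \<delta>\<^sup>2" if z: "z \<ge> y" for z
  proof -
    have "ln z - ln (z - \<delta>) \<le> (z - (z - \<delta>)) / (z - \<delta>)"
      using z \<delta> y by (intro ln_diff_le) auto
    also have "\<dots> \<le> \<delta> / (y - 1)" using z \<delta> y by (auto intro!: divide_left_mono)
    finally show ?thesis by (simp add: \<delta>_def power2_eq_square)
  qed
  have d: "ln (z\<^sup>2 + 2) / 2 - ln z \<le> \<delta>\<^sup>2" if z: "z \<ge> y" for z
  proof -
    have "ln (z\<^sup>2 + 2) - ln (z\<^sup>2) \<le> (z\<^sup>2 + 2 - z\<^sup>2) / z\<^sup>2"
      using z y by (intro ln_diff_le) (auto simp: add_nonneg_pos)
    also have "\<dots> \<le> 2 * \<delta>\<^sup>2"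
      using z y by (auto simp: \<delta>_def power_divide intro!: divide_left_mono power_mono)
    finally show ?thesis using z y by (simp add: ln_realpow)
  qed
  have L: "q \<le> ln (y + 1) - ln y"
    using ln_diff_le[of y "y + 1"] y by (simp add: q_def)
  have "\<delta>\<^sup>2 \<le> (11 / 10 * q)\<^sup>2" using \<delta> \<delta>q by (intro power_mono) auto
  also have "\<dots> = 121 / 100 * q * q" by (simp add: power2_eq_square)
  also have "\<dots> \<le> 121 / 100 * q * (1 / 100)" using q by (intro mult_left_mono) auto
  finally have dq: "\<delta>\<^sup>2 \<le> 121 / 10000 * q" by simp
  have "rate_lower y = (ln (y - \<delta>) + ln (y + 1 - \<delta>)) / 2"
    by (simp add: rate_lower_def \<delta>_def)
  then show ?thesis
    using c[OF order_refl] c[of "y + 1", simplified] d[OF order_refl] d[of "y + 1", simplified] L dq q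
    unfolding rate_upper_def by argo
qed

section \<open>Invariant functions and existence of the exponents\<close>

text \<open>Each superlevel set is invariant, hence null or conull, and the constant is the supremum
  of the conull thresholds. Invariance at every point of the space makes these sets exactly
  invariant, as the definition of ergodicity demands.\<close>

lemma ergodic_invariant_AE_const:
  fixes g :: "'a \<Rightarrow> ereal"
  assumes erg: "ergodic_transformation M T"
    and g [measurable]: "g \<in> borel_measurable M"
    and inv: "\<And>\<omega>. \<omega> \<in> space M \<Longrightarrow> g (T \<omega>) = g \<omega>"
    and bnd: "\<And>\<omega>. \<omega> \<in> space M \<Longrightarrow> \<bar>g \<omega>\<bar> \<le> ereal K"
    and nonnull: "emeasure M (space M) \<noteq> 0"
  shows "\<exists>L. AE \<omega> in M. g \<omega> = ereal L"
proof -
  define h where "h \<omega> = real_of_ereal (g \<omega>)" for \<omega>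
  have h [measurable]: "h \<in> borel_measurable M" unfolding h_def by measurable
  have gh: "g \<omega> = ereal (h \<omega>)" if "\<omega> \<in> space M" for \<omega>
    using bnd[OF that] unfolding h_def by (cases "g \<omega>") auto
  have hK: "\<bar>h \<omega>\<bar> \<le> K" if "\<omega> \<in> space M" for \<omega>
    using bnd[OF that] gh[OF that] by simp
  have T: "T \<in> M \<rightarrow>\<^sub>M M" using erg by (simp add: ergodic_transformation_def)
  define Q where "Q = {q. AE \<omega> in M. q \<le> h \<omega>}"
  have zero_one: "(AE \<omega> in M. q \<le> h \<omega>) \<or> (AE \<omega> in M. h \<omega> < q)" for q
  proof -
    let ?A = "{\<omega> \<in> space M. q \<le> h \<omega>}"
    have A: "?A \<in> sets M" by measurable
    have "T -` ?A \<inter> space M = ?A"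
      using measurable_space[OF T] inv by (auto simp: h_def)
    with erg A have "emeasure M ?A = 0 \<or> emeasure M (space M - ?A) = 0"
      by (auto simp: ergodic_transformation_def)
    then show ?thesis
    proof
      assume "emeasure M ?A = 0"
      then have "AE \<omega> in M. h \<omega> < q" using A by (intro AE_I[where N = ?A]) auto
      then show ?thesis ..
    next
      assume "emeasure M (space M - ?A) = 0"
      then have "AE \<omega> in M. q \<le> h \<omega>" using A by (intro AE_I[where N = "space M - ?A"]) auto
      then show ?thesis ..
    qed
  qed
  \<comment> \<open>The supremum of \<open>Q\<close> is meaningful because \<open>Q\<close> is
    nonempty and bounded. Boundedness would fail on a null space, where every real lies in
    \<open>Q\<close>.\<close>
  have "- K \<in> Q"
    unfolding Q_def using hK by (auto intro!: AE_I2 simp: abs_le_iff minus_le_iff)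
  have ub: "q \<le> K" if "q \<in> Q" for q
  proof (rule ccontr)
    assume "\<not> q \<le> K"
    have "AE \<omega> in M. q \<le> h \<omega>" using that by (simp add: Q_def)
    then have "AE \<omega> in M. False"
      using AE_space by eventually_elim (use hK \<open>\<not> q \<le> K\<close> in fastforce)
    with nonnull show False
      using AE_iff_measurable[of "space M" M "\<lambda>_. False"] by simp
  qed
  then have bdd: "bdd_above Q" by (auto simp: bdd_above_def)
  define c where "c = Sup Q"
  have "AE \<omega> in M. c - 1 / real (Suc n) \<le> h \<omega>" for n
  proof -
    have "c - 1 / real (Suc n) < Sup Q" by (simp add: c_def)
    then obtain q where "q \<in> Q" "c - 1 / real (Suc n) < q"
      using less_cSup_iff[OF _ bdd] \<open>- K \<in> Q\<close> by blast
    then show ?thesis by (auto simp: Q_def elim!: eventually_mono)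
  qed
  then have lower: "AE \<omega> in M. \<forall>n. c - 1 / real (Suc n) \<le> h \<omega>"
    by (simp add: AE_all_countable)
  have "AE \<omega> in M. h \<omega> \<le> c + 1 / real (Suc n)" for n
  proof -
    have "c + 1 / real (Suc n) \<notin> Q"
      using cSup_upper[OF _ bdd, of "c + 1 / real (Suc n)"] by (auto simp: c_def)
    with zero_one[of "c + 1 / real (Suc n)"] have "AE \<omega> in M. h \<omega> < c + 1 / real (Suc n)"
      by (auto simp: Q_def)
    then show ?thesis by eventually_elim simp
  qed
  then have upper: "AE \<omega> in M. \<forall>n. h \<omega> \<le> c + 1 / real (Suc n)"
    by (simp add: AE_all_countable)
  have "AE \<omega> in M. g \<omega> = ereal c"
    using lower upper AE_space
  proof eventually_elim
    case (elim \<omega>)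
    have "(\<lambda>n. 1 / real (Suc n)) \<longlonglongrightarrow> 0" by (rule LIMSEQ_Suc[OF lim_1_over_n])
    then have "(\<lambda>n. c - 1 / real (Suc n)) \<longlonglongrightarrow> c - 0" "(\<lambda>n. c + 1 / real (Suc n)) \<longlonglongrightarrow> c + 0"
      by (intro tendsto_intros; assumption)+
    then have "c - 0 \<le> h \<omega>" "h \<omega> \<le> c + 0"
      using elim by (auto intro: LIMSEQ_le_const LIMSEQ_le_const2)
    then show ?case using gh[OF elim(3)] by simp
  qed
  then show ?thesis ..
qed

text \<open>With finitely many values per coordinate every function of them, norm and logarithm
  included, is again simple, so measurability follows without continuity of the matrix
  operations.\<close>

lemma growth_rate_measurable:
  assumes "\<And>k. simple_function M (\<lambda>\<omega>. X \<omega> k)"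
  shows "(\<lambda>\<omega>. growth_rate (X \<omega>)) \<in> borel_measurable M"
proof -
  have prod: "simple_function M (\<lambda>\<omega>. schroedinger_product (X \<omega>) n)" for n
  proof (induction n)
    case (Suc n)
    show ?case
      using simple_function_compose2[OF assms[of n] Suc, of "\<lambda>t A. schroedinger_step t ** A"] by simp
  qed simp
  have "simple_function M (\<lambda>\<omega>. 1 / real n * ln (opnorm (schroedinger_product (X \<omega>) n)))" for n
    using simple_function_compose1[OF prod[of n], of "\<lambda>A. 1 / real n * ln (opnorm A)"] by simp
  then have "(\<lambda>\<omega>. 1 / real n * ln (opnorm (schroedinger_product (X \<omega>) n))) \<in> borel_measurable M" for n
    by (rule borel_measurable_simple_function)
  note [measurable] = this
  show ?thesis unfolding growth_rate_def by measurable
qed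

text \<open>\<open>U\<close> will be \<open>T\<close> or its inverse. Invariance is asked under
  \<open>T\<close> in both cases, so ergodicity of \<open>T\<close> serves both time
  directions.\<close>

lemma growth_rate_orbit_AE_const:
  assumes erg: "ergodic_transformation M T"
    and U: "U \<in> M \<rightarrow>\<^sub>M M"
    and f: "f \<in> borel_measurable M" "finite (f ` space M)"
    and nonnull: "emeasure M (space M) \<noteq> 0"
    and UT: "\<And>\<omega> k. \<omega> \<in> space M \<Longrightarrow>
      growth_rate (\<lambda>k. E - f ((U ^^ k) (T \<omega>))) = growth_rate (\<lambda>k. E - f ((U ^^ k) \<omega>))"
  shows "\<exists>L. AE \<omega> in M. growth_rate (\<lambda>k. E - f ((U ^^ k) \<omega>)) = ereal L"
proof -
  have Uk: "U ^^ k \<in> M \<rightarrow>\<^sub>M M" for k by (rule measurable_compose_n[OF U])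
  obtain B where B: "\<And>\<omega>. \<omega> \<in> space M \<Longrightarrow> \<bar>f \<omega>\<bar> \<le> B"
    using finite_imp_bounded[OF f(2)] by (auto simp: bounded_iff)
  define C where "C = sqrt ((\<bar>E\<bar> + B)\<^sup>2 + 2)"
  have "simple_function M f" by (rule simple_function_borel_measurable[OF f])
  show ?thesis
  proof (rule ergodic_invariant_AE_const[OF erg])
    show "(\<lambda>\<omega>. growth_rate (\<lambda>k. E - f ((U ^^ k) \<omega>))) \<in> borel_measurable M"
    proof (rule growth_rate_measurable)
      fix k
      have "(\<lambda>\<omega>. f ((U ^^ k) \<omega>)) \<in> borel_measurable M"
        using measurable_comp[OF Uk f(1)] by (simp add: comp_def)
      moreover have "finite ((\<lambda>\<omega>. f ((U ^^ k) \<omega>)) ` space M)"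
        using measurable_space[OF Uk] by (intro finite_subset[OF _ f(2)]) auto
      ultimately have "simple_function M (\<lambda>\<omega>. f ((U ^^ k) \<omega>))"
        by (rule simple_function_borel_measurable)
      from simple_function_compose1[OF this] show "simple_function M (\<lambda>\<omega>. E - f ((U ^^ k) \<omega>))" .
    qed
  next
    fix \<omega> assume \<omega>: "\<omega> \<in> space M"
    have bnd: "sqrt ((E - f ((U ^^ k) \<omega>))\<^sup>2 + 2) \<le> C" for k
    proof -
      have "\<bar>E - f ((U ^^ k) \<omega>)\<bar> \<le> \<bar>E\<bar> + B"
        using B[OF measurable_space[OF Uk \<omega>], of k] by linarith
      then have "\<bar>E - f ((U ^^ k) \<omega>)\<bar>\<^sup>2 \<le> (\<bar>E\<bar> + B)\<^sup>2"
        by (intro power_mono) auto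
      then show ?thesis by (simp add: C_def)
    qed
    show "\<bar>growth_rate (\<lambda>k. E - f ((U ^^ k) \<omega>))\<bar> \<le> ereal (ln C)"
      using growth_rate_finite[of "\<lambda>k. E - f ((U ^^ k) \<omega>)" C] bnd
      by (intro ereal_abs_leI) (auto simp: ereal_uminus_le_reorder)
  qed (use UT nonnull in auto)
qed

lemma growth_rate_shift_bounded:
  assumes "\<And>k. \<bar>x k\<bar> \<le> B"
  shows "growth_rate (\<lambda>k. x (Suc k)) = growth_rate x"
proof (rule growth_rate_shift)
  fix k
  have "\<bar>x k\<bar>\<^sup>2 \<le> B\<^sup>2" using assms by (intro power_mono) auto
  then show "sqrt ((x k)\<^sup>2 + 2) \<le> sqrt (B\<^sup>2 + 2)" by simp
qed

context
  fixes M :: "'a measure" and T :: "'a \<Rightarrow> 'a" and f :: "'a \<Rightarrow> real"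
  assumes erg: "ergodic_transformation M T"
    and inv: "invertible_transformation M T"
    and f: "f \<in> borel_measurable M" "finite (f ` space M)"
    and nonnull: "emeasure M (space M) \<noteq> 0"
begin

private lemma orbit_shift:
  assumes U: "U \<in> M \<rightarrow>\<^sub>M M" and \<omega>: "\<omega> \<in> space M"
  shows "growth_rate (\<lambda>k. E - f ((U ^^ Suc k) \<omega>)) = growth_rate (\<lambda>k. E - f ((U ^^ k) \<omega>))"
proof -
  obtain B where B: "\<And>\<omega>. \<omega> \<in> space M \<Longrightarrow> \<bar>f \<omega>\<bar> \<le> B"
    using finite_imp_bounded[OF f(2)] by (auto simp: bounded_iff)
  have "\<bar>E - f ((U ^^ k) \<omega>)\<bar> \<le> \<bar>E\<bar> + B" for k
    using B[OF measurable_space[OF measurable_compose_n[OF U] \<omega>], of k] by linarith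
  then show ?thesis by (rule growth_rate_shift_bounded)
qed

lemma has_lower_lyapunov_plus_exists: "\<exists>L. has_lower_lyapunov_plus M T f E L"
proof -
  have T: "T \<in> M \<rightarrow>\<^sub>M M" using inv by (simp add: invertible_transformation_def)
  have "\<exists>L. AE \<omega> in M. growth_rate (\<lambda>k. E - f ((T ^^ k) \<omega>)) = ereal L"
  proof (rule growth_rate_orbit_AE_const[OF erg T f nonnull])
    fix \<omega> assume "\<omega> \<in> space M"
    from orbit_shift[OF T this]
    show "growth_rate (\<lambda>k. E - f ((T ^^ k) (T \<omega>))) = growth_rate (\<lambda>k. E - f ((T ^^ k) \<omega>))"
      by (simp add: funpow_swap1)
  qed
  then show ?thesis
    unfolding has_lower_lyapunov_plus_def Liminf_lyapunov_quotient_at_top .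
qed

lemma has_lower_lyapunov_minus_exists: "\<exists>L. has_lower_lyapunov_minus M T f E L"
proof -
  let ?U = "inv_into (space M) T"
  have T: "T \<in> M \<rightarrow>\<^sub>M M" and U: "?U \<in> M \<rightarrow>\<^sub>M M" and inj: "inj_on T (space M)"
    using inv by (auto simp: invertible_transformation_def bij_betw_def)
  have "\<exists>L. AE \<omega> in M. growth_rate (\<lambda>k. E - f ((?U ^^ k) \<omega>)) = ereal L"
  proof (rule growth_rate_orbit_AE_const[OF erg U f nonnull])
    fix \<omega> assume \<omega>: "\<omega> \<in> space M"
    then have "(?U ^^ Suc k) (T \<omega>) = (?U ^^ k) \<omega>" for k
      by (simp add: funpow_Suc_right inv_into_f_f[OF inj] del: funpow.simps)
    then show "growth_rate (\<lambda>k. E - f ((?U ^^ k) (T \<omega>))) = growth_rate (\<lambda>k. E - f ((?U ^^ k) \<omega>))"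
      using orbit_shift[OF U measurable_space[OF T \<omega>]] by simp
  qed
  then obtain L where "AE \<omega> in M. growth_rate (\<lambda>k. E - f ((?U ^^ k) \<omega>)) = ereal L" by blast
  \<comment> \<open>The exponent reads the backward orbit from its first preimage on; one shift
    leaves the growth rate unchanged.\<close>
  then have "AE \<omega> in M. growth_rate (\<lambda>k. E - f ((?U ^^ Suc k) \<omega>)) = ereal L"
    using AE_space by eventually_elim (simp only: orbit_shift[OF U])
  then show ?thesis
    unfolding has_lower_lyapunov_minus_def Liminf_lyapunov_quotient_at_bot by blast
qed

end

section \<open>Skyscrapers\<close>

text \<open>The second coordinate is countable and discrete, so measurability can be checked one
  floor at a time.\<close>

lemma measurable_pair_nat:
  assumes [measurable]: "\<And>i. (\<lambda>x. f (x, i)) \<in> N \<rightarrow>\<^sub>M K"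
  shows "f \<in> (N \<Otimes>\<^sub>M count_space (UNIV :: nat set)) \<rightarrow>\<^sub>M K"
proof -
  have "(\<lambda>p. f (fst p, snd p)) \<in> (N \<Otimes>\<^sub>M count_space (UNIV :: nat set)) \<rightarrow>\<^sub>M K"
    by (rule measurable_compose_countable[where f = "\<lambda>i p. f (fst p, i)" and g = snd]) measurable
  then show ?thesis by simp
qed

text \<open>The base map acts on the whole type and carries an explicit inverse, so the backward
  step from the ground floor is a formula: it leads to the top of the tower over
  \<open>S' x\<close>. Positive heights make the whole base the ground floor.\<close>

locale skyscraper = prob_space N for N :: "'a measure" +
  fixes S S' :: "'a \<Rightarrow> 'a" and r :: "'a \<Rightarrow> nat"
  assumes space_N [simp]: "space N = UNIV"
    and S_meas [measurable]: "S \<in> N \<rightarrow>\<^sub>M N"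
    and S'_meas [measurable]: "S' \<in> N \<rightarrow>\<^sub>M N"
    and S'_S [simp]: "S' (S x) = x"
    and S_S' [simp]: "S (S' x) = x"
    and S_preserving: "B \<in> sets N \<Longrightarrow> emeasure N (S -` B) = emeasure N B"
    and S_ergodic: "B \<in> sets N \<Longrightarrow> S -` B = B \<Longrightarrow> emeasure N B = 0 \<or> emeasure N (- B) = 0"
    and r_meas [measurable]: "r \<in> N \<rightarrow>\<^sub>M count_space UNIV"
    and r_pos: "0 < r x"
begin

definition tower :: "('a \<times> nat) set" where
  "tower = {p. snd p < r (fst p)}"

definition sky :: "('a \<times> nat) measure" where
  "sky = restrict_space (N \<Otimes>\<^sub>M count_space UNIV) tower"

definition step :: "'a \<times> nat \<Rightarrow> 'a \<times> nat" where
  "step p = (if Suc (snd p) < r (fst p) then (fst p, Suc (snd p)) else (S (fst p), 0))"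

definition unstep :: "'a \<times> nat \<Rightarrow> 'a \<times> nat" where
  "unstep p = (if snd p = 0 then (S' (fst p), r (S' (fst p)) - 1) else (fst p, snd p - 1))"

section \<open>Measure and measurability, floor by floor\<close>

lemma S_vimage_sets [measurable (raw)]: "B \<in> sets N \<Longrightarrow> S -` B \<in> sets N"
  using measurable_sets[OF S_meas] by simp

lemma r_borel [measurable]: "r \<in> borel_measurable N"
  using measurable_compose[OF r_meas, of "\<lambda>x. x" borel] by simp

lemma tower_sets: "tower \<in> sets (N \<Otimes>\<^sub>M count_space UNIV)"
proof -
  have "(\<lambda>p. snd p < r (fst p)) \<in> (N \<Otimes>\<^sub>M count_space UNIV) \<rightarrow>\<^sub>M count_space UNIV"
    by (rule measurable_pair_nat) simp_all
  then show ?thesis by (simp add: tower_def pred_def space_pair_measure)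
qed

lemma space_sky: "space sky = tower"
  by (simp add: sky_def space_restrict_space space_pair_measure)

lemma sets_sky_iff: "B \<in> sets sky \<longleftrightarrow> B \<subseteq> tower \<and> B \<in> sets (N \<Otimes>\<^sub>M count_space UNIV)"
  unfolding sky_def using tower_sets
  by (subst sets_restrict_space_iff) (auto simp: space_pair_measure)

lemma section_sets [measurable (raw)]: "B \<in> sets sky \<Longrightarrow> {x. (x, i) \<in> B} \<in> sets N"
  using sets_Pair2[of B N "count_space UNIV" i] by (simp add: sets_sky_iff vimage_def)

lemma emeasure_sky:
  assumes "B \<in> sets sky"
  shows "emeasure sky B = (\<Sum>i. emeasure N {x. (x, i) \<in> B})"
proof -
  interpret C: sigma_finite_measure "count_space (UNIV :: nat set)"
    by (rule sigma_finite_measure_count_space)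
  interpret P: pair_sigma_finite N "count_space (UNIV :: nat set)" ..
  have "emeasure sky B = emeasure (N \<Otimes>\<^sub>M count_space UNIV) B"
    using assms tower_sets unfolding sky_def
    by (subst emeasure_restrict_space) (auto simp: space_pair_measure sets_restrict_space_iff)
  also have "\<dots> = (\<Sum>i. emeasure N {x. (x, i) \<in> B})"
    using assms by (simp add: P.emeasure_pair_measure_alt2 nn_integral_count_space_nat
        sets_sky_iff vimage_def)
  finally show ?thesis .
qed

lemma sigma_finite_sky: "sigma_finite_measure sky"
proof -
  interpret C: sigma_finite_measure "count_space (UNIV :: nat set)"
    by (rule sigma_finite_measure_count_space)
  interpret P: pair_sigma_finite N "count_space (UNIV :: nat set)" ..
  show ?thesis unfolding sky_def
    by (intro sigma_finite_measure_restrict_space tower_sets P.sigma_finite_measure_axioms)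
qed

lemma step_in_tower: "p \<in> tower \<Longrightarrow> step p \<in> tower"
  using r_pos by (auto simp: tower_def step_def)

lemma unstep_in_tower: "p \<in> tower \<Longrightarrow> unstep p \<in> tower"
  using r_pos by (auto simp: tower_def unstep_def)

lemma unstep_step: "p \<in> tower \<Longrightarrow> unstep (step p) = p"
  by (cases p) (auto simp: tower_def step_def unstep_def)

lemma step_unstep: "p \<in> tower \<Longrightarrow> step (unstep p) = p"
  using r_pos[of "S' (fst p)"] by (cases p) (auto simp: tower_def step_def unstep_def)

lemma step_meas: "step \<in> sky \<rightarrow>\<^sub>M sky"
  unfolding sky_def
proof (rule measurable_restrict_space3)
  show "step \<in> (N \<Otimes>\<^sub>M count_space UNIV) \<rightarrow>\<^sub>M (N \<Otimes>\<^sub>M count_space UNIV)"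
  proof (rule measurable_pair_nat)
    fix i
    show "(\<lambda>x. step (x, i)) \<in> N \<rightarrow>\<^sub>M (N \<Otimes>\<^sub>M count_space UNIV)"
      unfolding step_def fst_conv snd_conv by measurable
  qed
qed (use step_in_tower in auto)

lemma unstep_meas: "unstep \<in> sky \<rightarrow>\<^sub>M sky"
  unfolding sky_def
proof (rule measurable_restrict_space3)
  show "unstep \<in> (N \<Otimes>\<^sub>M count_space UNIV) \<rightarrow>\<^sub>M (N \<Otimes>\<^sub>M count_space UNIV)"
  proof (rule measurable_pair_nat)
    fix i
    show "(\<lambda>x. unstep (x, i)) \<in> N \<rightarrow>\<^sub>M (N \<Otimes>\<^sub>M count_space UNIV)"
      by (cases i) (simp_all add: unstep_def)
  qed
qed (use unstep_in_tower in auto)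

lemma bij_step: "bij_betw step tower tower"
  by (rule bij_betw_byWitness[where f' = unstep])
     (auto simp: unstep_step step_unstep step_in_tower unstep_in_tower)

lemma inv_into_step: "p \<in> space sky \<Longrightarrow> inv_into (space sky) step p = unstep p"
  unfolding space_sky
  by (rule inv_into_f_eq) (use bij_step in \<open>auto simp: bij_betw_def step_unstep unstep_in_tower\<close>)

lemma invertible_step: "invertible_transformation sky step"
proof -
  have "inv_into (space sky) step \<in> sky \<rightarrow>\<^sub>M sky"
    using unstep_meas by (subst measurable_cong[where g = unstep]) (simp_all add: inv_into_step space_sky[symmetric])
  then show ?thesis
    unfolding invertible_transformation_def using step_meas bij_step by (simp add: space_sky)
qed

text \<open>Floor i of the preimage consists of points that climb into \<open>B' (Suc i)\<close> and
  of top-floor points \<open>C i\<close> that fall into \<open>B' 0\<close>. Over all i the latter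
  partition the preimage of \<open>B' 0\<close> under \<open>S\<close>, which supplies the missing
  ground-floor term.\<close>

lemma measure_preserving_step: "measure_preserving_transformation sky step"
  unfolding measure_preserving_transformation_def
proof (intro conjI ballI step_meas)
  fix B assume B [measurable]: "B \<in> sets sky"
  then have Bt: "(x, i) \<in> B \<Longrightarrow> i < r x" for x i
    by (auto simp: sets_sky_iff tower_def)
  define B' where "B' i = {x. (x, i) \<in> B}" for i
  define C where "C i = {x. r x = Suc i} \<inter> S -` B' 0" for i
  have [measurable]: "B' i \<in> sets N" for i
    unfolding B'_def by measurable
  have "{x \<in> space N. r x = Suc i} \<in> sets N" for i by measurable
  then have C_sets [measurable]: "C i \<in> sets N" for i
    unfolding C_def by simp
  have "emeasure sky (step -` B \<inter> space sky)
      = (\<Sum>i. emeasure N {x. (x, i) \<in> step -` B \<inter> space sky})"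
    by (intro emeasure_sky measurable_sets[OF step_meas B])
  also have "\<dots> = (\<Sum>i. emeasure N (B' (Suc i)) + emeasure N (C i))"
  proof (rule suminf_cong)
    fix i
    have "{x. (x, i) \<in> step -` B \<inter> space sky} = B' (Suc i) \<union> C i"
      using Bt by (auto simp: step_def space_sky tower_def B'_def C_def split: if_splits)
    moreover have "B' (Suc i) \<inter> C i = {}"
      using Bt by (fastforce simp: B'_def C_def)
    ultimately show "emeasure N {x. (x, i) \<in> step -` B \<inter> space sky}
        = emeasure N (B' (Suc i)) + emeasure N (C i)"
      by (simp add: plus_emeasure)
  qed
  also have "\<dots> = (\<Sum>i. emeasure N (B' (Suc i))) + (\<Sum>i. emeasure N (C i))"
    by (simp add: suminf_add)
  also have "(\<Sum>i. emeasure N (C i)) = emeasure N (\<Union>i. C i)"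
    by (rule suminf_emeasure) (auto simp: disjoint_family_on_def C_def)
  also have "(\<Union>i. C i) = S -` B' 0"
    using r_pos by (auto simp: C_def) (metis Suc_pred)
  also have "emeasure N (S -` B' 0) = emeasure N (B' 0)"
    by (rule S_preserving) measurable
  also have "(\<Sum>i. emeasure N (B' (Suc i))) + emeasure N (B' 0) = (\<Sum>i. emeasure N (B' i))"
    using suminf_offset[of "\<lambda>i. emeasure N (B' i)" 1] by simp
  also have "\<dots> = emeasure sky B"
    unfolding B'_def by (rule emeasure_sky[OF B, symmetric])
  finally show "emeasure sky (step -` B \<inter> space sky) = emeasure sky B" .
qed

section \<open>Recurrence and ergodicity through the ground floor\<close>

lemma funpow_step_level: "j < r x \<Longrightarrow> (step ^^ j) (x, 0) = (x, j)"
  by (induction j) (auto simp: step_def)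

lemma funpow_step_top: "(step ^^ r x) (x, 0) = (S x, 0)"
proof -
  obtain j where j: "r x = Suc j" using r_pos[of x] gr0_implies_Suc by blast
  then show ?thesis using funpow_step_level[of j x] by (simp add: step_def)
qed

lemma funpow_step_base: "\<exists>t\<ge>m. (step ^^ t) (x, 0) = ((S ^^ m) x, 0)"
proof (induction m)
  case (Suc m)
  then obtain t where t: "t \<ge> m" "(step ^^ t) (x, 0) = ((S ^^ m) x, 0)" by blast
  let ?y = "(S ^^ m) x"
  have "(step ^^ (r ?y + t)) (x, 0) = ((S ^^ Suc m) x, 0)"
    by (simp add: funpow_add t funpow_step_top)
  moreover have "r ?y + t \<ge> Suc m" using t r_pos[of ?y] by simp
  ultimately show ?case by blast
qed (auto intro: exI[of _ 0])

text \<open>Poincare recurrence: without a return the preimages of \<open>W\<close> would be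
  disjoint sets of equal positive measure in a probability space.\<close>

lemma S_recurrent:
  assumes W [measurable]: "W \<in> sets N" and pos: "emeasure N W > 0"
  shows "\<exists>x\<in>W. \<exists>m>0. (S ^^ m) x \<in> W"
proof (rule ccontr)
  assume no: "\<not> ?thesis"
  have meas: "(S ^^ n) -` W \<in> sets N \<and> emeasure N ((S ^^ n) -` W) = emeasure N W" for n
  proof (induction n)
    case (Suc n)
    have "(S ^^ Suc n) -` W = S -` ((S ^^ n) -` W)"
      by (auto simp: funpow_swap1)
    then show ?case using Suc S_preserving S_vimage_sets by metis
  qed simp
  have less: "(S ^^ m) -` W \<inter> (S ^^ n) -` W = {}" if "m < n" for m n
  proof (rule ccontr)
    assume "\<not> ?thesis"
    then obtain x where x: "(S ^^ m) x \<in> W" "(S ^^ n) x \<in> W" by auto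
    have "(S ^^ n) x = (S ^^ (n - m)) ((S ^^ m) x)"
      using that by (metis add_diff_inverse_nat add.commute comp_apply funpow_add less_imp_not_less)
    moreover have "n - m > 0" using that by simp
    ultimately show False using x no by metis
  qed
  have "(S ^^ m) -` W \<inter> (S ^^ n) -` W = {}" if "m \<noteq> n" for m n
    using less[of m n] less[of n m] that by (cases m n rule: linorder_cases) auto
  then have "disjoint_family (\<lambda>n. (S ^^ n) -` W)"
    by (auto simp: disjoint_family_on_def)
  then have "(\<Sum>n. emeasure N ((S ^^ n) -` W)) = emeasure N (\<Union>n. (S ^^ n) -` W)"
    using meas by (intro suminf_emeasure) auto
  moreover have "(\<Sum>n. emeasure N ((S ^^ n) -` W)) = \<infinity>"
  proof -
    have "(\<Sum>n. emeasure N W) = emeasure N W * (\<Sum>n. 1)"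
      using ennreal_suminf_cmult[of "emeasure N W" "\<lambda>_. 1"] by simp
    moreover have "(\<Sum>n::nat. (1::ennreal)) = \<infinity>"
      using nn_integral_count_space_nat[of "\<lambda>_. 1"] by simp
    ultimately show ?thesis using meas pos
      by (simp add: ennreal_mult_eq_top_iff)
  qed
  ultimately show False
    using emeasure_finite[of "\<Union>n. (S ^^ n) -` W"] by (metis infinity_ennreal_def)
qed

text \<open>The total mass may be infinite, so Poincare recurrence is applied to a level set in the base.\<close>

lemma conservative_step: "conservative_transformation sky step"
  unfolding conservative_transformation_def
proof (intro conjI step_meas notI)
  assume "\<exists>W\<in>sets sky. emeasure sky W > 0 \<and> disjoint_family (\<lambda>n::nat. (step ^^ n) -` W \<inter> space sky)"
  then obtain W where W [measurable]: "W \<in> sets sky" and pos: "emeasure sky W > 0"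
    and disj: "disjoint_family (\<lambda>n::nat. (step ^^ n) -` W \<inter> space sky)" by blast
  have "\<exists>i. emeasure N {x. (x, i) \<in> W} > 0"
  proof (rule ccontr)
    assume "\<not> ?thesis"
    then have "emeasure sky W = 0" by (simp add: emeasure_sky)
    with pos show False by simp
  qed
  then obtain i where "emeasure N {x. (x, i) \<in> W} > 0" by blast
  from S_recurrent[OF _ this] obtain x m
    where x: "(x, i) \<in> W" "m > 0" "((S ^^ m) x, i) \<in> W" by auto
  from x have i: "i < r x" "i < r ((S ^^ m) x)" and xt: "(x, i) \<in> space sky"
    using W by (auto simp: sets_sky_iff tower_def space_sky)
  obtain m' where m': "m = Suc m'" using x(2) gr0_implies_Suc by blast
  obtain t where t: "(step ^^ t) (S x, 0) = ((S ^^ m') (S x), 0)"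
    using funpow_step_base by blast
  \<comment> \<open>The orbit from (x, i) to \<open>((S ^^ m) x, i)\<close>: r x - i steps finish
    the tower, t steps lead to the ground floor over \<open>(S ^^ m) x\<close>, and i steps climb.
    The return time is positive because i < r x.\<close>
  have "(step ^^ (r x - i)) (x, i) = (step ^^ (r x - i)) ((step ^^ i) (x, 0))"
    using i funpow_step_level by simp
  also have "\<dots> = (step ^^ (r x - i + i)) (x, 0)"
    by (simp only: funpow_add comp_apply)
  also have "\<dots> = (S x, 0)"
    using i funpow_step_top by simp
  finally have "(step ^^ (i + t + (r x - i))) (x, i) = (step ^^ i) ((step ^^ t) (S x, 0))"
    by (simp only: funpow_add comp_apply)
  also have "\<dots> = (step ^^ i) ((S ^^ m) x, 0)"
    unfolding t m' by (simp add: funpow_swap1)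
  also have "\<dots> = ((S ^^ m) x, i)"
    by (rule funpow_step_level[OF i(2)])
  finally have 1: "(x, i) \<in> (step ^^ (i + t + (r x - i))) -` W \<inter> space sky"
    using x xt by simp
  have 2: "(x, i) \<in> (step ^^ 0) -` W \<inter> space sky"
    using x xt by simp
  have "i + t + (r x - i) \<noteq> 0" using i by simp
  from disjoint_family_onD[OF disj UNIV_I UNIV_I this] 1 2 show False by blast
qed

text \<open>An invariant set is a union of entire towers, hence determined by its trace
  \<open>B0\<close> on the ground floor; passing from the top of a tower to the next shows that
  \<open>B0\<close> is invariant under the base map.\<close>

lemma ergodic_step: "ergodic_transformation sky step"
  unfolding ergodic_transformation_def
proof (intro conjI step_meas ballI impI)
  fix B assume B [measurable]: "B \<in> sets sky" and inv: "step -` B \<inter> space sky = B"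
  have step: "step p \<in> B \<longleftrightarrow> p \<in> B" if "p \<in> tower" for p
    using inv that by (auto simp: space_sky)
  define B0 where "B0 = {x. (x, 0) \<in> B}"
  have B0 [measurable]: "B0 \<in> sets N" unfolding B0_def by measurable
  have level: "(x, i) \<in> B \<longleftrightarrow> x \<in> B0" if "i < r x" for x i
    using that
  proof (induction i)
    case (Suc i)
    then have "step (x, i) = (x, Suc i)" "(x, i) \<in> tower"
      by (auto simp: step_def tower_def)
    with step[of "(x, i)"] Suc show ?case by simp
  qed (simp add: B0_def)
  have "S -` B0 = B0"
  proof (intro set_eqI)
    fix x
    have "step (x, r x - 1) = (S x, 0)" "(x, r x - 1) \<in> tower"
      using r_pos[of x] by (auto simp: step_def tower_def)
    with step[of "(x, r x - 1)"] level[of "r x - 1" x] r_pos[of x]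
    show "x \<in> S -` B0 \<longleftrightarrow> x \<in> B0" by (simp add: B0_def)
  qed
  from S_ergodic[OF B0 this] show "emeasure sky B = 0 \<or> emeasure sky (space sky - B) = 0"
  proof
    assume 0: "emeasure N B0 = 0"
    have "emeasure N {x. (x, i) \<in> B} = 0" for i
    proof (rule emeasure_eq_0[OF B0 0])
      show "{x. (x, i) \<in> B} \<subseteq> B0"
        using level B by (auto simp: sets_sky_iff tower_def)
    qed
    then show ?thesis by (simp add: emeasure_sky)
  next
    assume 0: "emeasure N (- B0) = 0"
    have "- B0 \<in> sets N" using sets.compl_sets[OF B0] by (simp add: Compl_eq_Diff_UNIV)
    have "emeasure N {x. (x, i) \<in> space sky - B} = 0" for i
    proof (rule emeasure_eq_0[OF \<open>- B0 \<in> sets N\<close> 0])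
      show "{x. (x, i) \<in> space sky - B} \<subseteq> - B0"
        using level by (auto simp: space_sky tower_def)
    qed
    then show ?thesis by (simp add: emeasure_sky)
  qed
qed

text \<open>The ground floor carries a full copy of \<open>N\<close>, so a null set of the
  skyscraper meets it in a null set.\<close>

lemma AE_sky_base:
  assumes "AE p in sky. P p"
  shows "AE x in N. P (x, 0)"
proof -
  from assms obtain Z where Z: "Z \<in> sets sky" "emeasure sky Z = 0" "{p \<in> space sky. \<not> P p} \<subseteq> Z"
    by (force elim: AE_E)
  have "emeasure N {x. (x, 0) \<in> Z} = 0"
    using Z(2) unfolding emeasure_sky[OF Z(1)]
    by (simp add: suminf_eq_zero_iff)
  moreover have "{x \<in> space N. \<not> P (x, 0)} \<subseteq> {x. (x, 0) \<in> Z}"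
    using Z(3) r_pos by (auto simp: space_sky tower_def)
  ultimately show ?thesis
    using section_sets[OF Z(1)] by (intro AE_I)
qed

end

section \<open>The dyadic odometer\<close>

definition coin :: "bool measure" where
  "coin = measure_pmf (pmf_of_set UNIV)"

definition cantor_measure :: "(nat \<Rightarrow> bool) measure" where
  "cantor_measure = (\<Pi>\<^sub>M i\<in>UNIV. coin)"

interpretation coin: prob_space coin
  by (simp add: coin_def measure_pmf.prob_space_axioms)

interpretation coins: product_prob_space "\<lambda>_::nat. coin" UNIV
  by unfold_locales

interpretation cantor: prob_space cantor_measure
  by (simp add: cantor_measure_def coins.P.prob_space_axioms)

lemma sets_coin [simp, measurable_cong]: "sets coin = sets (count_space UNIV)"
  by (simp add: coin_def)

lemma space_coin [simp]: "space coin = UNIV"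
  by (simp add: coin_def)

lemma space_cantor [simp]: "space cantor_measure = UNIV"
  by (simp add: cantor_measure_def space_PiM)

lemma sets_cantor [measurable_cong]: "sets cantor_measure = sets (\<Pi>\<^sub>M i\<in>(UNIV::nat set). count_space (UNIV::bool set))"
  unfolding cantor_measure_def by (intro sets_PiM_cong) auto

lemma emeasure_coin_vimage_Not: "emeasure coin (Not -` A) = emeasure coin A"
proof -
  have "card (Not -` A) = card A"
    by (rule card_vimage_inj) (auto simp: inj_def intro: range_eqI[of _ Not "\<not> _"])
  then show ?thesis
    by (simp add: coin_def emeasure_pmf_of_set)
qed

lemma emeasure_coin_single: "emeasure coin {b} = ennreal (1 / 2)"
  by (simp add: coin_def emeasure_pmf_single)

lemma emeasure_cylinder:
  assumes "finite J"
  shows "emeasure cantor_measure {x. \<forall>i\<in>J. x i \<in> F i} = (\<Prod>i\<in>J. emeasure coin (F i))"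
  using coins.emeasure_PiM_Collect[of J F] assms by (simp add: cantor_measure_def space_PiM)

lemma emeasure_cylinder_point:
  assumes "finite J"
  shows "emeasure cantor_measure {x. \<forall>i\<in>J. x i = b i} = ennreal ((1 / 2) ^ card J)"
  using emeasure_cylinder[OF assms, of "\<lambda>i. {b i}"]
  by (simp add: emeasure_coin_single ennreal_power del: ennreal_half)

lemma cylinder_sets [measurable]: "Measurable.pred cantor_measure (\<lambda>x. x i)"
  by measurable

lemma Collect_sets_cantor:
  "Measurable.pred cantor_measure P \<Longrightarrow> {x. P x} \<in> sets cantor_measure"
  by (simp add: pred_def)

lemma emeasure_eventually_constant: "emeasure cantor_measure {x. \<forall>i\<ge>m. x i = b} = 0"
proof -
  have "emeasure cantor_measure {x. \<forall>i\<ge>m. x i = b} \<le> ennreal ((1 / 2) ^ n)" for n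
  proof -
    have "emeasure cantor_measure {x. \<forall>i\<ge>m. x i = b} \<le> emeasure cantor_measure {x. \<forall>i\<in>{m..<m+n}. x i = b}"
      by (intro emeasure_mono Collect_sets_cantor) (auto, measurable)
    also have "\<dots> = ennreal ((1 / 2) ^ n)"
      by (subst emeasure_cylinder_point) auto
    finally show ?thesis .
  qed
  moreover have "(\<lambda>n. ennreal ((1 / 2) ^ n)) \<longlonglongrightarrow> ennreal 0"
    by (intro tendsto_ennrealI LIMSEQ_realpow_zero) auto
  ultimately have "emeasure cantor_measure {x. \<forall>i\<ge>m. x i = b} \<le> ennreal 0"
    by (intro LIMSEQ_le_const) auto
  then show ?thesis by simp
qed

lemma AE_not_eventually_constant: "AE x in cantor_measure. \<exists>\<^sub>\<infinity>i. x i = b"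
proof -
  have "AE x in cantor_measure. \<not> (\<forall>i\<ge>m. x i = (\<not> b))" for m
    by (rule AE_I[OF _ emeasure_eventually_constant[of m "\<not> b"]])
      (auto intro!: Collect_sets_cantor, measurable)
  then have "AE x in cantor_measure. \<forall>m. \<not> (\<forall>i\<ge>m. x i = (\<not> b))"
    by (simp add: AE_all_countable)
  then show ?thesis
    by eventually_elim (auto simp: INFM_nat_le)
qed

text \<open>Addition of 1 with carry, lowest digit first: digit n changes exactly when all lower
  digits are set. The all-true sequence wraps around to the all-false one, so the map is a bijection
  of the whole type.\<close>

definition odometer :: "(nat \<Rightarrow> bool) \<Rightarrow> nat \<Rightarrow> bool" where
  "odometer x n \<longleftrightarrow> x n \<noteq> (\<forall>m<n. x m)"

definition odometer_inv :: "(nat \<Rightarrow> bool) \<Rightarrow> nat \<Rightarrow> bool" where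
  "odometer_inv x n \<longleftrightarrow> x n \<noteq> (\<forall>m<n. \<not> x m)"

lemma odometer_inv_odometer [simp]: "odometer_inv (odometer x) = x"
proof
  fix n
  have "(\<forall>m<n. \<not> odometer x m) \<longleftrightarrow> (\<forall>m<n. x m)"
  proof (induction n)
    case (Suc n)
    show ?case unfolding All_less_Suc Suc.IH odometer_def[of x n] by blast
  qed simp
  then show "odometer_inv (odometer x) n = x n"
    by (simp only: odometer_inv_def[of _ n] odometer_def[of _ n]) blast
qed

lemma odometer_odometer_inv [simp]: "odometer (odometer_inv x) = x"
proof
  fix n
  have "(\<forall>m<n. odometer_inv x m) \<longleftrightarrow> (\<forall>m<n. \<not> x m)"
  proof (induction n)
    case (Suc n)
    show ?case unfolding All_less_Suc Suc.IH odometer_inv_def[of x n] by blast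
  qed simp
  then show "odometer (odometer_inv x) n = x n"
    by (simp only: odometer_inv_def[of _ n] odometer_def[of _ n]) blast
qed

lemma measurable_odometer [measurable]: "odometer \<in> cantor_measure \<rightarrow>\<^sub>M cantor_measure"
  unfolding cantor_measure_def
  by (rule measurable_PiM_single') (auto simp: odometer_def[abs_def] simp flip: cantor_measure_def)

lemma measurable_odometer_inv [measurable]: "odometer_inv \<in> cantor_measure \<rightarrow>\<^sub>M cantor_measure"
  unfolding cantor_measure_def
  by (rule measurable_PiM_single') (auto simp: odometer_inv_def[abs_def] simp flip: cantor_measure_def)

text \<open>Agrees with the odometer where the carry stops at digit k. It negates finitely many
  independent fair coins, hence preserves the product measure.\<close>

definition flip_upto :: "nat \<Rightarrow> (nat \<Rightarrow> bool) \<Rightarrow> nat \<Rightarrow> bool" where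
  "flip_upto k x i \<longleftrightarrow> (if i \<le> k then \<not> x i else x i)"

lemma measurable_flip_upto [measurable]: "flip_upto k \<in> cantor_measure \<rightarrow>\<^sub>M cantor_measure"
  unfolding cantor_measure_def
  by (rule measurable_PiM_single') (auto simp: flip_upto_def[abs_def] simp flip: cantor_measure_def)

lemma distr_flip_upto: "distr cantor_measure cantor_measure (flip_upto k) = cantor_measure"
proof -
  have "distr cantor_measure cantor_measure (flip_upto k) = (\<Pi>\<^sub>M i\<in>UNIV. coin)"
  proof (rule coins.PiM_eq)
    fix J :: "nat set" and F :: "nat \<Rightarrow> bool set"
    assume J: "finite J"
    have flip: "flip_upto k x i \<in> F i \<longleftrightarrow> x i \<in> (if i \<le> k then Not -` F i else F i)" for x i
      by (simp add: flip_upto_def)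
    have "prod_emb UNIV (\<lambda>_. coin) J (Pi\<^sub>E J F) \<in> sets cantor_measure"
      using J by (auto simp: cantor_measure_def intro: sets_PiM_I)
    then have "emeasure (distr cantor_measure cantor_measure (flip_upto k))
        (prod_emb UNIV (\<lambda>_. coin) J (Pi\<^sub>E J F))
      = emeasure cantor_measure (flip_upto k -` prod_emb UNIV (\<lambda>_. coin) J (Pi\<^sub>E J F) \<inter> UNIV)"
      by (subst emeasure_distr) auto
    also have "flip_upto k -` prod_emb UNIV (\<lambda>_. coin) J (Pi\<^sub>E J F) \<inter> UNIV
      = {x. \<forall>i\<in>J. x i \<in> (if i \<le> k then Not -` F i else F i)}"
      by (auto simp: prod_emb_def PiE_iff flip split del: if_split)
    also have "emeasure cantor_measure \<dots> = (\<Prod>i\<in>J. emeasure coin (F i))"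
      using J by (subst emeasure_cylinder) (auto intro!: prod.cong simp: emeasure_coin_vimage_Not)
    finally show "emeasure (distr cantor_measure cantor_measure (flip_upto k))
        (prod_emb UNIV (\<lambda>_. coin) J (Pi\<^sub>E J F)) = (\<Prod>i\<in>J. emeasure coin (F i))" .
  qed (simp add: cantor_measure_def)
  then show ?thesis by (simp add: cantor_measure_def)
qed

text \<open>On \<open>V k\<close>, where the carry stops at digit k, the odometer is a flip of
  finitely many digits, and it leads to \<open>D k\<close>, where the first set digit is k. Each
  family partitions the space up to a single point, so the pieces add up.\<close>

lemma emeasure_odometer_vimage:
  assumes B [measurable]: "B \<in> sets cantor_measure"
  shows "emeasure cantor_measure (odometer -` B) = emeasure cantor_measure B"
proof -
  define V where "V k = {x::nat \<Rightarrow> bool. (\<forall>i<k. x i) \<and> \<not> x k}" for k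
  define D where "D k = {x::nat \<Rightarrow> bool. (\<forall>i<k. \<not> x i) \<and> x k}" for k
  have [measurable]: "V k \<in> sets cantor_measure" "D k \<in> sets cantor_measure" for k
    unfolding V_def D_def by (intro Collect_sets_cantor; measurable)+
  have disj: "disjoint_family V" "disjoint_family D"
    unfolding disjoint_family_on_def V_def D_def by (auto, (metis linorder_neqE_nat)+)
  have disj': "disjoint_family (\<lambda>k. odometer -` B \<inter> V k)" "disjoint_family (\<lambda>k. B \<inter> D k)"
    using disj unfolding disjoint_family_on_def by blast+
  have ex: "\<exists>k. P k \<and> (\<forall>i<k. \<not> P i)" if "\<exists>k. P k" for P :: "nat \<Rightarrow> bool"
    using that exists_least_iff by blast
  have V: "x \<in> (\<Union>k. V k) \<longleftrightarrow> \<not> (\<forall>i\<ge>0. x i = True)" for x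
    using ex[of "\<lambda>k. \<not> x k"] by (auto simp: V_def)
  have D: "x \<in> (\<Union>k. D k) \<longleftrightarrow> \<not> (\<forall>i\<ge>0. x i = False)" for x
    using ex[of x] by (auto simp: D_def)
  have AE_V: "AE x in cantor_measure. x \<in> (\<Union>k. V k)"
    by (rule AE_I[OF _ emeasure_eventually_constant[of 0 True]])
      (use V in \<open>auto intro!: Collect_sets_cantor\<close>)
  have AE_D: "AE x in cantor_measure. x \<in> (\<Union>k. D k)"
    by (rule AE_I[OF _ emeasure_eventually_constant[of 0 False]])
      (use D in \<open>auto intro!: Collect_sets_cantor\<close>)
  have S: "odometer -` B \<in> sets cantor_measure"
    using measurable_sets[OF measurable_odometer B] by simp
  have eq: "emeasure cantor_measure (odometer -` B \<inter> V k) = emeasure cantor_measure (B \<inter> D k)" for k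
  proof -
    have flip: "odometer x = flip_upto k x" if "x \<in> V k" for x
    proof
      fix n show "odometer x n = flip_upto k x n"
        using that by (cases n k rule: linorder_cases) (auto simp: V_def odometer_def flip_upto_def)
    qed
    have "x \<in> V k \<longleftrightarrow> flip_upto k x \<in> D k" for x
      by (auto simp: V_def D_def flip_upto_def)
    with flip have "odometer -` B \<inter> V k = flip_upto k -` (B \<inter> D k) \<inter> space cantor_measure"
      by auto
    then have "emeasure cantor_measure (odometer -` B \<inter> V k)
        = emeasure (distr cantor_measure cantor_measure (flip_upto k)) (B \<inter> D k)"
      by (simp add: emeasure_distr)
    then show ?thesis by (simp only: distr_flip_upto)
  qed
  have "emeasure cantor_measure (odometer -` B) = emeasure cantor_measure (\<Union>k. odometer -` B \<inter> V k)"
    using AE_V S by (intro emeasure_eq_AE) auto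
  also have "\<dots> = (\<Sum>k. emeasure cantor_measure (odometer -` B \<inter> V k))"
    using disj' S by (intro suminf_emeasure[symmetric]) auto
  also have "\<dots> = (\<Sum>k. emeasure cantor_measure (B \<inter> D k))"
    by (simp only: eq)
  also have "\<dots> = emeasure cantor_measure (\<Union>k. B \<inter> D k)"
    using disj' by (intro suminf_emeasure) auto
  also have "\<dots> = emeasure cantor_measure B"
    using AE_D by (intro emeasure_eq_AE) auto
  finally show ?thesis .
qed

section \<open>Ergodicity of the odometer by the zero-one law\<close>

lemma indep_coordinates:
  "cantor.indep_sets (\<lambda>i. {(\<lambda>x. x i) -` A |A. True}) UNIV"
proof -
  have "cantor.indep_vars (\<lambda>_. coin) (\<lambda>i x. x i) UNIV"
  proof (subst cantor.indep_vars_iff_distr_eq_PiM)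
    have "distr cantor_measure (\<Pi>\<^sub>M i\<in>UNIV. coin) (\<lambda>x. \<lambda>i\<in>UNIV. x i) = cantor_measure"
      unfolding cantor_measure_def by (simp add: restrict_def distr_id2)
    also have "\<dots> = (\<Pi>\<^sub>M i\<in>UNIV. distr cantor_measure coin (\<lambda>x. x i))"
      unfolding cantor_measure_def by (simp add: coins.PiM_component)
    finally show "distr cantor_measure (\<Pi>\<^sub>M i\<in>UNIV. coin) (\<lambda>x. \<lambda>i\<in>UNIV. x i)
        = (\<Pi>\<^sub>M i\<in>UNIV. distr cantor_measure coin (\<lambda>x. x i))" .
  qed (auto, measurable)
  then show ?thesis
    unfolding cantor.indep_vars_def2 by simp
qed

text \<open>To turn a clear digit n into a set one, first set all lower digits, which the induction
  hypothesis permits, and apply the odometer once: the carry sets digit n and leaves the higher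
  digits alone.\<close>

lemma odometer_orbit_first_digits:
  assumes inv: "\<And>x. x \<in> B \<longleftrightarrow> odometer x \<in> B"
    and eq: "\<And>i. n \<le> i \<Longrightarrow> x i = y i"
  shows "x \<in> B \<longleftrightarrow> y \<in> B"
  using eq
proof (induction n arbitrary: x y)
  case 0
  then have "x = y" by auto
  then show ?case by simp
next
  case (Suc n)
  have *: "x \<in> B \<longleftrightarrow> y \<in> B" if "\<not> x n" "y n" "\<And>i. Suc n \<le> i \<Longrightarrow> x i = y i" for x y
  proof -
    let ?z = "\<lambda>i. i < n \<or> (i > n \<and> x i)"
    have "x \<in> B \<longleftrightarrow> ?z \<in> B" using that by (intro Suc.IH) (auto simp: le_less)
    also have "\<dots> \<longleftrightarrow> odometer ?z \<in> B" by (rule inv)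
    also have "\<dots> \<longleftrightarrow> y \<in> B"
    proof (rule Suc.IH)
      fix i assume "n \<le> i"
      show "odometer ?z i = y i"
      proof (cases "i = n")
        case True
        with that show ?thesis by (simp add: odometer_def)
      next
        case False
        with \<open>n \<le> i\<close> have "n < i" by simp
        then have "\<not> (\<forall>m<i. ?z m)" by (auto intro!: exI[of _ n])
        with that \<open>n < i\<close> show ?thesis by (simp add: odometer_def)
      qed
    qed
    finally show ?thesis .
  qed
  show ?case
  proof (cases "x n = y n")
    case True
    show ?thesis
    proof (rule Suc.IH)
      fix i assume "n \<le> i"
      with True Suc.prems show "x i = y i"
        by (cases "i = n") auto
    qed
  next
    case False
    then show ?thesis using *[of x y] *[of y x] Suc.prems by blast
  qed
qed

text \<open>Sequences that differ in finitely many digits lie on one orbit, so an invariant set is a tail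
  event.\<close>

lemma odometer_ergodic:
  assumes B: "B \<in> sets cantor_measure" and inv: "odometer -` B = B"
  shows "emeasure cantor_measure B = 0 \<or> emeasure cantor_measure (- B) = 0"
proof -
  let ?A = "\<lambda>i. {(\<lambda>x::nat \<Rightarrow> bool. x i) -` A |A. True}"
  have tail: "B \<in> cantor.tail_events ?A"
    unfolding cantor.tail_events_def
  proof (safe)
    fix n
    let ?N = "sigma (UNIV :: (nat \<Rightarrow> bool) set) (\<Union> (?A ` {n..}))"
    \<comment> \<open>Clearing the first n digits yields a function of the later digits only and, by
      \<open>odometer_orbit_first_digits\<close>, does not change membership in \<open>B\<close>. So
      \<open>B\<close> lies in the sigma-algebra of the digits from n on.\<close>
    let ?g = "\<lambda>x i. n \<le> i \<and> x i"
    have "?g \<in> ?N \<rightarrow>\<^sub>M cantor_measure"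
      unfolding cantor_measure_def
    proof (rule measurable_PiM_single')
      fix i
      show "(\<lambda>x. n \<le> i \<and> x i) \<in> ?N \<rightarrow>\<^sub>M coin"
      proof (cases "n \<le> i")
        case True
        have "(\<lambda>x. x i) \<in> ?N \<rightarrow>\<^sub>M coin"
          by (rule measurableI) (use True in \<open>auto intro!: sigma_sets.Basic\<close>)
        with True show ?thesis by simp
      qed simp
    qed simp
    from measurable_sets[OF this B] have "?g -` B \<in> sigma_sets UNIV (\<Union> (?A ` {n..}))"
      by simp
    also have "?g -` B = B"
    proof (intro set_eqI)
      fix x
      have "?g x \<in> B \<longleftrightarrow> x \<in> B"
        by (rule odometer_orbit_first_digits[where n = n]) (use inv in blast, simp)
      then show "x \<in> ?g -` B \<longleftrightarrow> x \<in> B" by simp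
    qed
    finally show "B \<in> sigma_sets (space cantor_measure) (\<Union> (?A ` {n..}))" by simp
  qed
  have alg: "sigma_algebra (space cantor_measure) (?A i)" for i
  proof -
    have "?A i = sets (vimage_algebra UNIV (\<lambda>x. x i) coin)"
      by (auto simp: sets_vimage_algebra2)
    then show ?thesis
      using sets.sigma_algebra_axioms[of "vimage_algebra UNIV (\<lambda>x. x i) coin"] by simp
  qed
  have "cantor.prob B = 0 \<or> cantor.prob B = 1"
    by (rule cantor.kolmogorov_0_1_law[OF alg indep_coordinates tail])
  moreover have "cantor.prob (- B) = 1 - cantor.prob B"
    using cantor.prob_compl[OF B] by (simp add: Compl_eq_Diff_UNIV)
  ultimately show ?thesis
    by (metis cantor.emeasure_eq_measure diff_self ennreal_0)
qed

section \<open>The skyscraper over the odometer\<close>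

text \<open>The value at the constantly true sequence is unspecified; that point is null.\<close>

definition carry_level :: "(nat \<Rightarrow> bool) \<Rightarrow> nat" where
  "carry_level x = (LEAST k. \<not> x k)"

definition return_time :: "(nat \<Rightarrow> bool) \<Rightarrow> nat" where
  "return_time x = 2 * 20 ^ carry_level x"

lemma carry_level_eqI:
  assumes "\<And>i. i < k \<Longrightarrow> x i" "\<not> x k"
  shows "carry_level x = k"
  unfolding carry_level_def using assms by (intro Least_equality) (auto simp: not_less[symmetric])

lemma measurable_carry_level [measurable]: "carry_level \<in> cantor_measure \<rightarrow>\<^sub>M count_space UNIV"
  unfolding carry_level_def[abs_def] by measurable

interpretation tw: skyscraper cantor_measure odometer odometer_inv return_time
proof
  show "return_time \<in> cantor_measure \<rightarrow>\<^sub>M count_space UNIV"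
    unfolding return_time_def[abs_def] by measurable
qed (auto simp: emeasure_odometer_vimage odometer_ergodic return_time_def)

text \<open>Carry level k has base measure 1/2^(k + 1) and towers of height 2 * 20^k, so it alone
  contributes 10^k.\<close>

lemma infinite_sky: "emeasure tw.sky (space tw.sky) = \<infinity>"
proof -
  let ?m = "emeasure tw.sky (space tw.sky)"
  have ge: "ennreal (10 ^ k) \<le> ?m" for k
  proof -
    have half: "ennreal ((1 / 2) ^ Suc k) \<le> emeasure cantor_measure {x. (x, i) \<in> space tw.sky}"
      if "i < 2 * 20 ^ k" for i
    proof -
      have "ennreal ((1 / 2) ^ Suc k) = emeasure cantor_measure {x. \<forall>i\<in>{..k}. x i = (i < k)}"
        by (subst emeasure_cylinder_point) auto
      also have "\<dots> \<le> emeasure cantor_measure {x. (x, i) \<in> space tw.sky}"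
      proof (intro emeasure_mono)
        have "carry_level x = k" if "\<forall>i\<in>{..k}. x i = (i < k)" for x
          using that by (intro carry_level_eqI) auto
        then show "{x. \<forall>i\<in>{..k}. x i = (i < k)} \<subseteq> {x. (x, i) \<in> space tw.sky}"
          using that by (auto simp: tw.space_sky tw.tower_def return_time_def)
        show "{x. (x, i) \<in> space tw.sky} \<in> sets cantor_measure"
          by (rule tw.section_sets) simp
      qed
      finally show ?thesis .
    qed
    have "(20::real) ^ k * (1 / 2) ^ k = 10 ^ k"
      by (simp flip: power_mult_distrib)
    then have "ennreal (10 ^ k) = ennreal (\<Sum>i<(2::nat) * 20 ^ k. (1 / 2) ^ Suc k)"
      by simp
    also have "\<dots> = (\<Sum>i<(2::nat) * 20 ^ k. ennreal ((1 / 2) ^ Suc k))"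
      by (rule sum_ennreal[symmetric]) simp
    also have "\<dots> \<le> (\<Sum>i<(2::nat) * 20 ^ k. emeasure cantor_measure {x. (x, i) \<in> space tw.sky})"
      using half by (intro sum_mono) auto
    also have "\<dots> \<le> (\<Sum>i. emeasure cantor_measure {x. (x, i) \<in> space tw.sky})"
      by (intro sum_le_suminf) auto
    also have "\<dots> = ?m" by (rule tw.emeasure_sky[symmetric]) simp
    finally show ?thesis .
  qed
  show ?thesis
  proof (cases ?m)
    case (real c)
    obtain k where "c < 10 ^ k" using real_arch_pow[of 10 c] by auto
    with ge[of k] real show ?thesis by simp
  qed simp
qed

section \<open>Frequencies along ground-floor orbits\<close>

definition sampling :: "(nat \<Rightarrow> bool) \<times> nat \<Rightarrow> real" where
  "sampling p = (if 20 ^ carry_level (fst p) \<le> snd p then 1 else 0)"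

lemma sampling_values: "sampling p \<in> {0, 1}"
  by (simp add: sampling_def)

lemma sampling_nonneg: "0 \<le> sampling p" and sampling_le_1: "sampling p \<le> 1"
  by (simp_all add: sampling_def)

lemma sampling_measurable: "sampling \<in> borel_measurable tw.sky"
  unfolding tw.sky_def
proof (rule measurable_restrict_space1, rule measurable_pair_nat)
  fix i
  have "(\<lambda>x. (20::nat) ^ carry_level x) \<in> borel_measurable cantor_measure"
    by (rule measurable_compose[OF measurable_carry_level]) simp
  note [measurable] = this
  show "(\<lambda>x. sampling (x, i)) \<in> borel_measurable cantor_measure"
    unfolding sampling_def fst_conv snd_conv by measurable
qed

lemma sum_lessThan_add:
  fixes g :: "nat \<Rightarrow> real"
  shows "(\<Sum>k<a + b. g k) = (\<Sum>k<a. g k) + (\<Sum>k<b. g (a + k))"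
  by (induction b) (simp_all add: add.assoc)

lemma funpow_step_mid:
  "(tw.step ^^ (return_time x + k)) (x, 0) = (tw.step ^^ k) (odometer x, 0)"
  by (metis add.commute comp_apply funpow_add tw.funpow_step_top)

lemma funpow_unstep:
  assumes "k < return_time (odometer_inv x)"
  shows "(tw.unstep ^^ Suc k) (x, 0) = (odometer_inv x, return_time (odometer_inv x) - Suc k)"
  using assms
proof (induction k)
  case (Suc k)
  have "(tw.unstep ^^ Suc (Suc k)) (x, 0) = tw.unstep ((tw.unstep ^^ Suc k) (x, 0))" by simp
  also have "\<dots> = tw.unstep (odometer_inv x, return_time (odometer_inv x) - Suc k)"
    using Suc by (simp del: funpow.simps)
  also have "\<dots> = (odometer_inv x, return_time (odometer_inv x) - Suc (Suc k))"
    using Suc.prems by (simp add: tw.unstep_def)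
  finally show ?case .
qed (simp add: tw.unstep_def)

lemma funpow_unstep_bottom:
  "(tw.unstep ^^ return_time (odometer_inv x)) (x, 0) = (odometer_inv x, 0)"
proof -
  obtain j where j: "return_time (odometer_inv x) = Suc j"
    using tw.r_pos gr0_implies_Suc by blast
  then show ?thesis using funpow_unstep[of j x] by simp
qed

text \<open>Peel off the first full tower, which has exactly a ones on 2 * a floors. In an
  incomplete tower the zeros come first: the truncated difference m - a counts the ones seen, and it
  is at most m / 2 for m \<le> 2 * a.\<close>

lemma forward_sum_le: "(\<Sum>k<n. sampling ((tw.step ^^ k) (x, 0))) \<le> real n / 2"
proof (induction n arbitrary: x rule: less_induct)
  case (less n)
  define a :: nat where "a = 20 ^ carry_level x"
  have a: "a > 0" and r: "return_time x = 2 * a" by (simp_all add: a_def return_time_def)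
  have first: "(\<Sum>k<m. sampling ((tw.step ^^ k) (x, 0))) = real (m - a)" if "m \<le> 2 * a" for m
  proof -
    have "(\<Sum>k<m. sampling ((tw.step ^^ k) (x, 0))) = (\<Sum>k<m. if a \<le> k then 1 else 0)"
      using that r by (intro sum.cong) (auto simp: tw.funpow_step_level sampling_def a_def)
    also have "\<dots> = real (m - a)"
      by (induction m) (auto simp: Suc_diff_le)
    finally show ?thesis .
  qed
  show ?case
  proof (cases "n \<le> 2 * a")
    case True
    then show ?thesis by (simp add: first)
  next
    case False
    define m where "m = n - 2 * a"
    have n: "n = 2 * a + m" using False by (simp add: m_def)
    have "(\<Sum>k<n. sampling ((tw.step ^^ k) (x, 0)))
        = (\<Sum>k<2 * a. sampling ((tw.step ^^ k) (x, 0)))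
          + (\<Sum>k<m. sampling ((tw.step ^^ k) (odometer x, 0)))"
      unfolding n by (simp only: sum_lessThan_add funpow_step_mid flip: r)
    also have "\<dots> \<le> real a + real m / 2"
      using first[of "2 * a"] less.IH[of m "odometer x"] a n by simp
    finally show ?thesis by (simp add: n)
  qed
qed

text \<open>On the descent the ones come first: m \<le> 2 * a steps meet \<open>min m a\<close> of
  them, at least m / 2. Full towers again contribute exactly half.\<close>

lemma backward_sum_ge: "real n / 2 \<le> (\<Sum>k<n. sampling ((tw.unstep ^^ Suc k) (x, 0)))"
proof (induction n arbitrary: x rule: less_induct)
  case (less n)
  define y where "y = odometer_inv x"
  define a :: nat where "a = 20 ^ carry_level y"
  have a: "a > 0" and r: "return_time y = 2 * a" by (simp_all add: a_def return_time_def)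
  have first: "(\<Sum>k<m. sampling ((tw.unstep ^^ Suc k) (x, 0))) = real (min m a)" if "m \<le> 2 * a" for m
  proof -
    have "(\<Sum>k<m. sampling ((tw.unstep ^^ Suc k) (x, 0))) = (\<Sum>k<m. if k < a then 1 else 0)"
    proof (intro sum.cong refl)
      fix k assume "k \<in> {..<m}"
      with that have "k < 2 * a" by simp
      with funpow_unstep[of k x] r
      have "(tw.unstep ^^ Suc k) (x, 0) = (y, 2 * a - Suc k)" by (simp add: y_def)
      moreover have "a \<le> 2 * a - Suc k \<longleftrightarrow> k < a" using \<open>k < 2 * a\<close> by auto
      ultimately show "sampling ((tw.unstep ^^ Suc k) (x, 0)) = (if k < a then 1 else 0)"
        by (simp add: sampling_def a_def del: funpow.simps)
    qed
    also have "\<dots> = real (min m a)"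
      by (induction m) (auto simp: min_def)
    finally show ?thesis .
  qed
  show ?case
  proof (cases "n \<le> 2 * a")
    case True
    then show ?thesis by (simp add: first min_def del: funpow.simps)
  next
    case False
    define m where "m = n - 2 * a"
    have n: "n = 2 * a + m" using False by (simp add: m_def)
    have mid: "(tw.unstep ^^ Suc (2 * a + k)) (x, 0) = (tw.unstep ^^ Suc k) (y, 0)" for k
    proof -
      have "Suc (2 * a + k) = Suc k + return_time y" using r by simp
      then show ?thesis
        using funpow_unstep_bottom[of x] by (simp only: funpow_add comp_apply flip: y_def)
    qed
    have "real a + real m / 2 \<le> (\<Sum>k<2 * a. sampling ((tw.unstep ^^ Suc k) (x, 0)))
          + (\<Sum>k<m. sampling ((tw.unstep ^^ Suc k) (y, 0)))"
      using first[of "2 * a"] less.IH[of m y] a n by (simp add: min_def del: funpow.simps)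
    also have "\<dots> = (\<Sum>k<n. sampling ((tw.unstep ^^ Suc k) (x, 0)))"
      unfolding n by (simp only: sum_lessThan_add mid)
    finally show ?thesis by (simp add: n del: funpow.simps)
  qed
qed

text \<open>An upper bound for the time an orbit on the ground floor needs, in either direction, to reach
  a tower of height $2 \cdot 20^k$ once digit $k$ permits it. The base $20$ makes it at most $1/9$
  of half that height.\<close>

primrec block_length :: "nat \<Rightarrow> nat" where
  "block_length 0 = 0"
| "block_length (Suc k) = 2 * block_length k + 2 * 20 ^ k"

text \<open>The induction step is 2 * 20^k + 18 * 20^k = 20^(k + 1); here the base 20 is exactly
  sufficient.\<close>

lemma block_length_le: "9 * block_length k \<le> 20 ^ k"
  by (induction k) simp_all

text \<open>Counting up fills the first k digits without touching later ones. To fill a clear digit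
  k as well, cross the tower whose carry sets it and clears the lower digits, and fill those again;
  the recursion of \<open>block_length\<close> counts these two fillings and one tower.\<close>

lemma forward_block_end:
  "\<exists>t\<le>block_length k. \<exists>y. (tw.step ^^ t) (x, 0) = (y, 0) \<and> (\<forall>i<k. y i) \<and> (\<forall>i\<ge>k. y i = x i)"
proof (induction k arbitrary: x)
  case 0
  then show ?case by (intro exI[of _ 0]) auto
next
  case (Suc k)
  then obtain t y where t: "t \<le> block_length k" "(tw.step ^^ t) (x, 0) = (y, 0)"
    and y: "\<forall>i<k. y i" "\<forall>i\<ge>k. y i = x i" by blast
  show ?case
  proof (cases "x k")
    case True
    with y have "\<forall>i<Suc k. y i" "\<forall>i\<ge>Suc k. y i = x i" by (auto simp: less_Suc_eq)
    with t show ?thesis by (intro exI[of _ t] conjI exI[of _ y]) auto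
  next
    case False
    then have "return_time y = 2 * 20 ^ k"
      using y by (simp add: return_time_def carry_level_eqI)
    with tw.funpow_step_top[of y]
    have top: "(tw.step ^^ (2 * 20 ^ k)) (y, 0) = (odometer y, 0)" by simp
    from Suc obtain t' z where t': "t' \<le> block_length k" "(tw.step ^^ t') (odometer y, 0) = (z, 0)"
      and z: "\<forall>i<k. z i" "\<forall>i\<ge>k. z i = odometer y i" by blast
    have "odometer y i = x i" if "i \<ge> Suc k" for i
    proof -
      have "\<not> (\<forall>m<i. y m)" using that False y by (auto intro!: exI[of _ k])
      with that y show ?thesis by (simp add: odometer_def)
    qed
    moreover have "odometer y k" using False y by (simp add: odometer_def)
    ultimately have "\<forall>i<Suc k. z i" "\<forall>i\<ge>Suc k. z i = x i"
      using z by (auto simp: less_Suc_eq)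
    moreover have "(tw.step ^^ (t' + 2 * 20 ^ k + t)) (x, 0) = (z, 0)"
      by (simp only: funpow_add comp_apply t top t')
    moreover have "t' + 2 * 20 ^ k + t \<le> block_length (Suc k)"
      using t t' by simp
    ultimately show ?thesis by blast
  qed
qed

text \<open>Counting down clears the first k digits in the same way. The tower crossed lies over the
  predecessor \<open>w\<close> of \<open>y\<close>, so its height is governed by the digits after
  the borrow.\<close>

lemma backward_block_begin:
  "\<exists>t\<le>block_length k. \<exists>y. (tw.unstep ^^ t) (x, 0) = (y, 0) \<and> (\<forall>i<k. \<not> y i) \<and> (\<forall>i\<ge>k. y i = x i)"
proof (induction k arbitrary: x)
  case 0
  then show ?case by (intro exI[of _ 0]) auto
next
  case (Suc k)
  then obtain t y where t: "t \<le> block_length k" "(tw.unstep ^^ t) (x, 0) = (y, 0)"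
    and y: "\<forall>i<k. \<not> y i" "\<forall>i\<ge>k. y i = x i" by blast
  show ?case
  proof (cases "x k")
    case False
    with y have "\<forall>i<Suc k. \<not> y i" "\<forall>i\<ge>Suc k. y i = x i" by (auto simp: less_Suc_eq)
    with t show ?thesis by (intro exI[of _ t] conjI exI[of _ y]) auto
  next
    case True
    define w where "w = odometer_inv y"
    have wk: "\<not> w k" using True y by (simp add: w_def odometer_inv_def)
    have "w i" if "i < k" for i
      using that y by (auto simp: w_def odometer_inv_def)
    then have "return_time w = 2 * 20 ^ k"
      using wk by (simp add: return_time_def carry_level_eqI)
    with funpow_unstep_bottom[of y]
    have top: "(tw.unstep ^^ (2 * 20 ^ k)) (y, 0) = (w, 0)" by (simp add: w_def)
    from Suc obtain t' z where t': "t' \<le> block_length k" "(tw.unstep ^^ t') (w, 0) = (z, 0)"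
      and z: "\<forall>i<k. \<not> z i" "\<forall>i\<ge>k. z i = w i" by blast
    have "w i = x i" if "i \<ge> Suc k" for i
    proof -
      have "\<not> (\<forall>m<i. \<not> y m)" using that True y by (auto intro!: exI[of _ k])
      with that y show ?thesis by (simp add: w_def odometer_inv_def)
    qed
    with wk have "\<forall>i<Suc k. \<not> z i" "\<forall>i\<ge>Suc k. z i = x i"
      using z by (auto simp: less_Suc_eq)
    moreover have "(tw.unstep ^^ (t' + 2 * 20 ^ k + t)) (x, 0) = (z, 0)"
      by (simp only: funpow_add comp_apply t top t')
    moreover have "t' + 2 * 20 ^ k + t \<le> block_length (Suc k)"
      using t t' by simp
    ultimately show ?thesis by blast
  qed
qed

lemma nat_less_20_power: "k < (20::nat) ^ k"
  by (induction k) auto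

text \<open>Stop halfway up the tower of carry level k. At most t ones precede its 20^k zeros, and t
  is at most 1/10 of t + 20^k exactly when 9 * t \<le> 20^k.\<close>

lemma forward_frequently_small:
  assumes "\<exists>\<^sub>\<infinity>i. x i = False"
  shows "\<exists>\<^sub>F n in sequentially. (\<Sum>k<n. sampling ((tw.step ^^ k) (x, 0))) \<le> real n / 10"
  unfolding frequently_sequentially
proof
  fix N
  from assms obtain k where k: "k > N" "\<not> x k" by (auto simp: INFM_nat)
  obtain t y where t: "t \<le> block_length k" "(tw.step ^^ t) (x, 0) = (y, 0)"
    and y: "\<forall>i<k. y i" "\<forall>i\<ge>k. y i = x i"
    using forward_block_end[of k x] by blast
  have level: "carry_level y = k" using y k by (intro carry_level_eqI) auto
  have "(\<Sum>j<t + 20 ^ k. sampling ((tw.step ^^ j) (x, 0)))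
      = (\<Sum>j<t. sampling ((tw.step ^^ j) (x, 0)))
        + (\<Sum>j<20 ^ k. sampling ((tw.step ^^ (t + j)) (x, 0)))"
    by (rule sum_lessThan_add)
  also have "(\<Sum>j<20 ^ k. sampling ((tw.step ^^ (t + j)) (x, 0))) = 0"
  proof (intro sum.neutral ballI)
    fix j :: nat assume "j \<in> {..<20 ^ k}"
    then have j: "j < 20 ^ k" by simp
    have "(tw.step ^^ (t + j)) (x, 0) = (tw.step ^^ j) (y, 0)"
      by (simp add: add.commute[of t] funpow_add t)
    also have "\<dots> = (y, j)"
      using j level by (intro tw.funpow_step_level) (simp add: return_time_def)
    finally show "sampling ((tw.step ^^ (t + j)) (x, 0)) = 0"
      using j level by (simp add: sampling_def)
  qed
  also have "(\<Sum>j<t. sampling ((tw.step ^^ j) (x, 0))) + 0 \<le> (\<Sum>j<t. 1)"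
    using sum_mono[of "{..<t}", OF sampling_le_1] by simp
  also have "(\<Sum>j<t. 1) \<le> real (t + 20 ^ k) / 10"
  proof -
    have "9 * t \<le> 20 ^ k" using t(1) block_length_le[of k] by linarith
    then have "9 * real t \<le> 20 ^ k" by (simp flip: of_nat_le_iff[where 'a = real])
    then show ?thesis by simp
  qed
  finally have "(\<Sum>j<t + 20 ^ k. sampling ((tw.step ^^ j) (x, 0))) \<le> real (t + 20 ^ k) / 10" .
  moreover have "N \<le> t + 20 ^ k" using k nat_less_20_power[of k] by linarith
  ultimately show "\<exists>n\<ge>N. (\<Sum>k<n. sampling ((tw.step ^^ k) (x, 0))) \<le> real n / 10" by blast
qed

text \<open>Stop halfway down, after 20^k ones and at most t zeros. The count is of 1 - f, which is
  the sequence \<open>t\<close> of \<open>growth_rate_le\<close> for positive E.\<close>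

lemma backward_frequently_large:
  assumes "\<exists>\<^sub>\<infinity>i. x i = True"
  shows "\<exists>\<^sub>F n in sequentially.
    (\<Sum>k<n. 1 - sampling ((tw.unstep ^^ Suc k) (x, 0))) \<le> real n / 10"
  unfolding frequently_sequentially
proof
  fix N
  from assms obtain k where k: "k > N" "x k" by (auto simp: INFM_nat)
  obtain t y where t: "t \<le> block_length k" "(tw.unstep ^^ t) (x, 0) = (y, 0)"
    and y: "\<forall>i<k. \<not> y i" "\<forall>i\<ge>k. y i = x i"
    using backward_block_begin[of k x] by blast
  define w where "w = odometer_inv y"
  \<comment> \<open>The borrow stops at the set digit k: it clears that digit and sets all lower
    ones.\<close>
  have level: "carry_level w = k"
    using y k by (intro carry_level_eqI) (auto simp: w_def odometer_inv_def)
  have "(\<Sum>j<t + 20 ^ k. 1 - sampling ((tw.unstep ^^ Suc j) (x, 0)))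
      = (\<Sum>j<t. 1 - sampling ((tw.unstep ^^ Suc j) (x, 0)))
        + (\<Sum>j<20 ^ k. 1 - sampling ((tw.unstep ^^ Suc (t + j)) (x, 0)))"
    by (rule sum_lessThan_add)
  also have "(\<Sum>j<20 ^ k. 1 - sampling ((tw.unstep ^^ Suc (t + j)) (x, 0))) = 0"
  proof (intro sum.neutral ballI)
    fix j :: nat assume "j \<in> {..<20 ^ k}"
    then have j: "j < 20 ^ k" by simp
    have "Suc (t + j) = Suc j + t" by simp
    then have "(tw.unstep ^^ Suc (t + j)) (x, 0) = (tw.unstep ^^ Suc j) (y, 0)"
      by (simp only: funpow_add comp_apply t)
    also have "\<dots> = (w, return_time w - Suc j)"
      unfolding w_def by (rule funpow_unstep) (use j level in \<open>simp add: return_time_def w_def\<close>)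
    finally show "1 - sampling ((tw.unstep ^^ Suc (t + j)) (x, 0)) = 0"
      using j level by (simp add: sampling_def return_time_def del: funpow.simps)
  qed
  also have "(\<Sum>j<t. 1 - sampling ((tw.unstep ^^ Suc j) (x, 0))) + 0 \<le> (\<Sum>j<t. 1)"
    unfolding add_0_right by (rule sum_mono) (simp add: sampling_nonneg)
  also have "(\<Sum>j<t. 1) \<le> real (t + 20 ^ k) / 10"
  proof -
    have "9 * t \<le> 20 ^ k" using t(1) block_length_le[of k] by linarith
    then have "9 * real t \<le> 20 ^ k" by (simp flip: of_nat_le_iff[where 'a = real])
    then show ?thesis by simp
  qed
  finally have "(\<Sum>j<t + 20 ^ k. 1 - sampling ((tw.unstep ^^ Suc j) (x, 0))) \<le> real (t + 20 ^ k) / 10" .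
  moreover have "N \<le> t + 20 ^ k" using k nat_less_20_power[of k] by linarith
  ultimately show "\<exists>n\<ge>N. (\<Sum>k<n. 1 - sampling ((tw.unstep ^^ Suc k) (x, 0))) \<le> real n / 10" by blast
qed

section \<open>Comparison of the exponents at one point\<close>

lemma funpow_inv_into_step:
  assumes "p \<in> space tw.sky"
  shows "(inv_into (space tw.sky) tw.step ^^ k) p = (tw.unstep ^^ k) p \<and>
    (tw.unstep ^^ k) p \<in> space tw.sky"
  using assms
  by (induction k) (simp_all add: tw.inv_into_step tw.unstep_in_tower[folded tw.space_sky])

text \<open>Four properties of full measure hold together at some point; as the exponents are
  constants, this single orbit decides their comparison.\<close>

lemma base_point:
  assumes plus: "has_lower_lyapunov_plus tw.sky tw.step sampling E L"
    and minus: "has_lower_lyapunov_minus tw.sky tw.step sampling E L'"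
  obtains x where "\<exists>\<^sub>\<infinity>i. x i = True" "\<exists>\<^sub>\<infinity>i. x i = False"
    "growth_rate (\<lambda>k. E - sampling ((tw.step ^^ k) (x, 0))) = ereal L"
    "growth_rate (\<lambda>k. E - sampling ((tw.unstep ^^ Suc k) (x, 0))) = ereal L'"
proof -
  have "AE x in cantor_measure. growth_rate (\<lambda>k. E - sampling ((tw.step ^^ k) (x, 0))) = ereal L"
    using plus unfolding has_lower_lyapunov_plus_def Liminf_lyapunov_quotient_at_top
    by (rule tw.AE_sky_base)
  moreover have "AE x in cantor_measure.
      growth_rate (\<lambda>k. E - sampling ((inv_into (space tw.sky) tw.step ^^ Suc k) (x, 0))) = ereal L'"
    using minus unfolding has_lower_lyapunov_minus_def Liminf_lyapunov_quotient_at_bot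
    by (rule tw.AE_sky_base)
  ultimately have "AE x in cantor_measure. (\<exists>\<^sub>\<infinity>i. x i = True) \<and> (\<exists>\<^sub>\<infinity>i. x i = False) \<and>
      growth_rate (\<lambda>k. E - sampling ((tw.step ^^ k) (x, 0))) = ereal L \<and>
      growth_rate (\<lambda>k. E - sampling ((inv_into (space tw.sky) tw.step ^^ Suc k) (x, 0))) = ereal L'"
    using AE_not_eventually_constant[of True] AE_not_eventually_constant[of False]
    by eventually_elim blast
  then obtain x where x: "\<exists>\<^sub>\<infinity>i. x i = True" "\<exists>\<^sub>\<infinity>i. x i = False"
      "growth_rate (\<lambda>k. E - sampling ((tw.step ^^ k) (x, 0))) = ereal L"
      "growth_rate (\<lambda>k. E - sampling ((inv_into (space tw.sky) tw.step ^^ Suc k) (x, 0))) = ereal L'"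
    using eventually_happens[of _ "ae_filter cantor_measure"] cantor.ae_filter_bot by blast
  have "(x, 0) \<in> space tw.sky"
    using tw.r_pos by (simp add: tw.space_sky tw.tower_def)
  then have "growth_rate (\<lambda>k. E - sampling ((tw.unstep ^^ Suc k) (x, 0))) = ereal L'"
    using x(4) funpow_inv_into_step[of "(x, 0)"] by (simp only:)
  with x show thesis by (intro that)
qed

text \<open>Here |E - f| = (E - 1) + (1 - f), so the zeros of f give the larger modulus. Forward
  orbits have at least half of them at all times, backward orbits at most a tenth infinitely
  often.\<close>

lemma lower_lyapunov_large_energy:
  assumes E: "E > 100"
    and plus: "has_lower_lyapunov_plus tw.sky tw.step sampling E L"
    and minus: "has_lower_lyapunov_minus tw.sky tw.step sampling E L'"
  shows "L' < L"
proof -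
  obtain x where x: "\<exists>\<^sub>\<infinity>i. x i = True" "\<exists>\<^sub>\<infinity>i. x i = False"
    "growth_rate (\<lambda>k. E - sampling ((tw.step ^^ k) (x, 0))) = ereal L"
    "growth_rate (\<lambda>k. E - sampling ((tw.unstep ^^ Suc k) (x, 0))) = ereal L'"
    by (rule base_point[OF plus minus])
  have abs: "\<bar>E - sampling p\<bar> = (E - 1) + (1 - sampling p)" for p
    using E sampling_values[of p] by auto
  have t: "1 - sampling p \<in> {0, 1}" for p using sampling_values[of p] by auto
  have "ereal (rate_lower (E - 1)) \<le> ereal L"
    unfolding x(3)[symmetric]
  proof (rule growth_rate_ge[OF _ t abs])
    fix n show "real n / 2 \<le> (\<Sum>k<n. 1 - sampling ((tw.step ^^ k) (x, 0)))"
      using forward_sum_le[of x n] by (simp add: sum_subtractf)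
  qed (use E in simp)
  moreover have "ereal L' \<le> ereal (rate_upper (E - 1))"
    unfolding x(4)[symmetric]
    by (rule growth_rate_le[OF _ t abs]) (use E backward_frequently_large[OF x(1)] in simp_all)
  moreover have "rate_upper (E - 1) < rate_lower (E - 1)"
    using E by (intro rate_upper_less_rate_lower) simp
  ultimately show ?thesis by simp
qed

text \<open>Here |E - f| = -E + f, so the ones of f give the larger modulus and the two time
  directions exchange roles.\<close>

lemma lower_lyapunov_small_energy:
  assumes E: "E < - 100"
    and plus: "has_lower_lyapunov_plus tw.sky tw.step sampling E L"
    and minus: "has_lower_lyapunov_minus tw.sky tw.step sampling E L'"
  shows "L < L'"
proof -
  obtain x where x: "\<exists>\<^sub>\<infinity>i. x i = True" "\<exists>\<^sub>\<infinity>i. x i = False"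
    "growth_rate (\<lambda>k. E - sampling ((tw.step ^^ k) (x, 0))) = ereal L"
    "growth_rate (\<lambda>k. E - sampling ((tw.unstep ^^ Suc k) (x, 0))) = ereal L'"
    by (rule base_point[OF plus minus])
  have abs: "\<bar>E - sampling p\<bar> = - E + sampling p" for p
    using E sampling_values[of p] by auto
  have "ereal L \<le> ereal (rate_upper (- E))"
    unfolding x(3)[symmetric]
    by (rule growth_rate_le[OF _ sampling_values abs])
       (use E forward_frequently_small[OF x(2)] in simp_all)
  moreover have "ereal (rate_lower (- E)) \<le> ereal L'"
    unfolding x(4)[symmetric]
    by (rule growth_rate_ge[OF _ sampling_values abs]) (use E backward_sum_ge in simp_all)
  moreover have "rate_upper (- E) < rate_lower (- E)"
    using E by (intro rate_upper_less_rate_lower) simp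
  ultimately show ?thesis by simp
qed

section \<open>Transport to the real line\<close>

context
  fixes M :: "'a measure" and T :: "'a \<Rightarrow> 'a" and \<phi> :: "'a \<Rightarrow> 'b"
  assumes \<phi>: "inj \<phi>"
begin

text \<open>Outside the range of \<phi> the value of \<open>inv \<phi>\<close> is arbitrary, but
  \<open>embed_measure\<close> lives on the image of the space, where this map is the conjugate of
  \<open>T\<close>.\<close>

definition transported :: "'b \<Rightarrow> 'b" where
  "transported = (\<lambda>y. \<phi> (T (inv \<phi> y)))"

private abbreviation "M' \<equiv> embed_measure M \<phi>"

private lemma inv_\<phi> [simp]: "inv \<phi> (\<phi> x) = x"
  by (rule inv_f_f[OF \<phi>])

private lemma funpow_transported: "(transported ^^ n) (\<phi> x) = \<phi> ((T ^^ n) x)"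
  by (induction n) (simp_all add: transported_def)

lemma measurable_transport:
  assumes "U \<in> M \<rightarrow>\<^sub>M M"
  shows "(\<lambda>y. \<phi> (U (inv \<phi> y))) \<in> M' \<rightarrow>\<^sub>M M'"
  by (rule measurable_embed_measure1)
     (simp add: measurable_compose[OF assms measurable_embed_measure2[OF \<phi>]])

private lemma transported_measurable: "T \<in> M \<rightarrow>\<^sub>M M \<Longrightarrow> transported \<in> M' \<rightarrow>\<^sub>M M'"
  unfolding transported_def by (rule measurable_transport)

private lemma vimage_transported:
  "(transported ^^ n) -` (\<phi> ` B) \<inter> \<phi> ` C = \<phi> ` ((T ^^ n) -` B \<inter> C)"
  using \<phi> by (auto simp: funpow_transported inj_image_mem_iff dest: injD)

lemma measure_preserving_transport:
  assumes "measure_preserving_transformation M T"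
  shows "measure_preserving_transformation M' transported"
  unfolding measure_preserving_transformation_def
proof (intro conjI ballI)
  show "transported \<in> M' \<rightarrow>\<^sub>M M'"
    using assms transported_measurable by (simp add: measure_preserving_transformation_def)
  fix B assume "B \<in> sets M'"
  then obtain A where A: "B = \<phi> ` A" "A \<in> sets M" by (auto simp: sets_embed_measure[OF \<phi>])
  have T: "T \<in> M \<rightarrow>\<^sub>M M" using assms by (simp add: measure_preserving_transformation_def)
  have "emeasure M' (transported -` B \<inter> space M') = emeasure M' (\<phi> ` (T -` A \<inter> space M))"
    using vimage_transported[of 1 A "space M"] by (simp add: A space_embed_measure)
  also have "\<dots> = emeasure M (T -` A \<inter> space M)"
    by (rule emeasure_embed_measure_image[OF \<phi> measurable_sets[OF T A(2)]])
  also have "\<dots> = emeasure M A"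
    using assms A(2) by (simp add: measure_preserving_transformation_def)
  also have "\<dots> = emeasure M' B"
    using emeasure_embed_measure_image[OF \<phi> A(2)] A(1) by simp
  finally show "emeasure M' (transported -` B \<inter> space M') = emeasure M' B" .
qed

lemma ergodic_transport:
  assumes "ergodic_transformation M T"
  shows "ergodic_transformation M' transported"
  unfolding ergodic_transformation_def
proof (intro conjI ballI impI)
  show "transported \<in> M' \<rightarrow>\<^sub>M M'"
    using assms transported_measurable by (simp add: ergodic_transformation_def)
  fix B assume "B \<in> sets M'" and inv: "transported -` B \<inter> space M' = B"
  then obtain A where A: "B = \<phi> ` A" "A \<in> sets M" by (auto simp: sets_embed_measure[OF \<phi>])
  have "\<phi> ` (T -` A \<inter> space M) = \<phi> ` A"
    using vimage_transported[of 1 A "space M"] inv by (simp add: A space_embed_measure)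
  then have "T -` A \<inter> space M = A" by (simp add: inj_image_eq_iff[OF \<phi>])
  then have "emeasure M A = 0 \<or> emeasure M (space M - A) = 0"
    using assms A(2) by (simp add: ergodic_transformation_def)
  moreover have "space M' - B = \<phi> ` (space M - A)"
    by (simp add: A space_embed_measure image_set_diff[OF \<phi>])
  ultimately show "emeasure M' B = 0 \<or> emeasure M' (space M' - B) = 0"
    using A by (simp add: emeasure_embed_measure_image[OF \<phi>])
qed

lemma conservative_transport:
  assumes "conservative_transformation M T"
  shows "conservative_transformation M' transported"
  unfolding conservative_transformation_def
proof (intro conjI notI)
  show "transported \<in> M' \<rightarrow>\<^sub>M M'"
    using assms transported_measurable by (simp add: conservative_transformation_def)
  assume "\<exists>W\<in>sets M'. emeasure M' W > 0 \<and>
      disjoint_family (\<lambda>n::nat. (transported ^^ n) -` W \<inter> space M')"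
  then obtain A where A: "A \<in> sets M" "emeasure M' (\<phi> ` A) > 0"
    and disj: "disjoint_family (\<lambda>n::nat. (transported ^^ n) -` (\<phi> ` A) \<inter> space M')"
    by (auto simp: sets_embed_measure[OF \<phi>])
  have "disjoint_family (\<lambda>n::nat. (T ^^ n) -` A \<inter> space M)"
    using disj unfolding space_embed_measure vimage_transported disjoint_family_on_def
    by (simp flip: image_Int[OF \<phi>])
  moreover have "emeasure M A > 0"
    using A by (simp add: emeasure_embed_measure_image[OF \<phi>])
  ultimately show False
    using assms A(1) unfolding conservative_transformation_def by blast
qed

lemma inv_into_transported:
  assumes "bij_betw T (space M) (space M)" and "\<omega> \<in> space M"
  shows "inv_into (space M') transported (\<phi> \<omega>) = \<phi> (inv_into (space M) T \<omega>)"
proof (rule inv_into_f_eq)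
  have im: "T ` space M = space M" and inj: "inj_on T (space M)"
    using assms(1) by (auto simp: bij_betw_def)
  show "inj_on transported (space M')"
    using inj \<phi> by (auto simp: inj_on_def space_embed_measure transported_def)
  show "\<phi> (inv_into (space M) T \<omega>) \<in> space M'"
    using inv_into_into[of \<omega> T "space M"] im assms(2) by (auto simp: space_embed_measure)
  show "transported (\<phi> (inv_into (space M) T \<omega>)) = \<phi> \<omega>"
    using f_inv_into_f[of \<omega> T "space M"] im assms(2) by (simp add: transported_def)
qed

lemma invertible_transport:
  assumes "invertible_transformation M T"
  shows "invertible_transformation M' transported"
  unfolding invertible_transformation_def
proof (intro conjI)
  have T: "T \<in> M \<rightarrow>\<^sub>M M" and bij: "bij_betw T (space M) (space M)"
    and U: "inv_into (space M) T \<in> M \<rightarrow>\<^sub>M M"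
    using assms by (auto simp: invertible_transformation_def)
  show "transported \<in> M' \<rightarrow>\<^sub>M M'" by (rule transported_measurable[OF T])
  have "transported ` space M' = \<phi> ` (T ` space M)"
    by (auto simp: space_embed_measure transported_def image_image)
  then have "transported ` space M' = space M'"
    using bij by (simp add: bij_betw_def space_embed_measure)
  moreover have "inj_on transported (space M')"
    using bij \<phi> by (auto simp: bij_betw_def inj_on_def space_embed_measure transported_def)
  ultimately show "bij_betw transported (space M') (space M')"
    by (simp add: bij_betw_def)
  have "inv_into (space M') transported y = \<phi> (inv_into (space M) T (inv \<phi> y))"
    if "y \<in> space M'" for y
  proof -
    from that obtain x where "y = \<phi> x" "x \<in> space M" by (auto simp: space_embed_measure)
    with inv_into_transported[OF bij] show ?thesis by simp
  qed
  then show "inv_into (space M') transported \<in> M' \<rightarrow>\<^sub>M M'"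
    by (rule measurable_cong[THEN iffD2, OF _ measurable_transport[OF U]])
qed

lemma has_lower_lyapunov_plus_transport:
  assumes "has_lower_lyapunov_plus M T f E L"
  shows "has_lower_lyapunov_plus M' transported (\<lambda>y. f (inv \<phi> y)) E L"
  using assms unfolding has_lower_lyapunov_plus_def Liminf_lyapunov_quotient_at_top
  by (simp add: AE_embed_measure[OF \<phi>] funpow_transported)

lemma has_lower_lyapunov_minus_transport:
  assumes inv: "invertible_transformation M T" and L: "has_lower_lyapunov_minus M T f E L"
  shows "has_lower_lyapunov_minus M' transported (\<lambda>y. f (inv \<phi> y)) E L"
proof -
  let ?U = "inv_into (space M) T" and ?U' = "inv_into (space M') transported"
  have bij: "bij_betw T (space M) (space M)" and U: "?U \<in> M \<rightarrow>\<^sub>M M"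
    using inv by (auto simp: invertible_transformation_def)
  \<comment> \<open>The two inverses correspond only at points of the space, so the induction also
    uses that the backward orbit stays inside it.\<close>
  have pow: "(?U' ^^ n) (\<phi> \<omega>) = \<phi> ((?U ^^ n) \<omega>)" if "\<omega> \<in> space M" for n \<omega>
    using measurable_space[OF measurable_compose_n[OF U] that]
    by (induction n) (simp_all add: inv_into_transported[OF bij])
  have "AE \<omega> in M. growth_rate (\<lambda>k. E - f ((?U ^^ Suc k) \<omega>)) = ereal L"
    using L unfolding has_lower_lyapunov_minus_def Liminf_lyapunov_quotient_at_bot .
  then have "AE \<omega> in M. growth_rate (\<lambda>k. E - f (inv \<phi> ((?U' ^^ Suc k) (\<phi> \<omega>)))) = ereal L"
    using AE_space by eventually_elim (simp only: pow inv_\<phi>)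
  then show ?thesis
    unfolding has_lower_lyapunov_minus_def Liminf_lyapunov_quotient_at_bot
    by (simp only: AE_embed_measure[OF \<phi>])
qed

end

text \<open>A point is coded as a set of naturals whose odd elements record the digits and whose
  only even element records the floor; sets of naturals are equinumerous with the reals.\<close>

lemma ex_inj_cantor_nat_real: "\<exists>\<phi> :: (nat \<Rightarrow> bool) \<times> nat \<Rightarrow> real. inj \<phi>"
proof -
  obtain g :: "nat set \<Rightarrow> real" where "bij g"
    using nat_sets_eqpoll_reals by (auto simp: eqpoll_def)
  define e :: "(nat \<Rightarrow> bool) \<times> nat \<Rightarrow> nat set" where
    "e p = insert (2 * snd p) {2 * n + 1 |n. fst p n}" for p
  have "inj e"
  proof (rule injI)
    fix p q assume eq: "e p = e q"
    have "Suc (2 * n) \<noteq> 2 * m" "2 * m \<noteq> Suc (2 * n)" for m n :: nat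
      by presburger+
    then have odd: "2 * n + 1 \<in> e p \<longleftrightarrow> fst p n" and even: "2 * n \<in> e p \<longleftrightarrow> n = snd p" for n p
      by (auto simp: e_def)
    have "fst p = fst q" using odd[of _ p] odd[of _ q] eq by (intro ext) simp
    moreover have "snd p = snd q" using even[of "snd p" p] even[of "snd p" q] eq by simp
    ultimately show "p = q" by (rule prod_eqI)
  qed
  then have "inj (g \<circ> e)" using \<open>bij g\<close> by (simp add: bij_def inj_compose)
  then show ?thesis by blast
qed

theorem proposition6p6:
  "\<exists>(\<Omega> :: real measure) (T :: real \<Rightarrow> real) (f :: real \<Rightarrow> real) (M :: real)
      (Lplus :: real \<Rightarrow> real) (Lminus :: real \<Rightarrow> real).
     sigma_finite_measure \<Omega> \<and> emeasure \<Omega> (space \<Omega>) = \<infinity> \<and>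
     conservative_transformation \<Omega> T \<and> invertible_transformation \<Omega> T \<and>
     measure_preserving_transformation \<Omega> T \<and> ergodic_transformation \<Omega> T \<and>
     f \<in> borel_measurable \<Omega> \<and> bounded (f ` space \<Omega>) \<and>
     M > 0 \<and>
     (\<forall>E. has_lower_lyapunov_plus \<Omega> T f E (Lplus E)) \<and>
     (\<forall>E. has_lower_lyapunov_minus \<Omega> T f E (Lminus E)) \<and>
     (\<forall>E. E > M \<longrightarrow> Lplus E > Lminus E) \<and>
     (\<forall>E. E < - M \<longrightarrow> Lplus E < Lminus E)"
proof -
  have fin: "finite (sampling ` space tw.sky)"
    by (rule finite_subset[OF image_subsetI[OF sampling_values]]) simp
  have nonnull: "emeasure tw.sky (space tw.sky) \<noteq> 0"
    by (simp add: infinite_sky)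
  note exists = has_lower_lyapunov_plus_exists has_lower_lyapunov_minus_exists
  note exists = exists[OF tw.ergodic_step tw.invertible_step sampling_measurable fin nonnull]
  obtain Lplus where plus: "\<And>E. has_lower_lyapunov_plus tw.sky tw.step sampling E (Lplus E)"
    using exists(1) by metis
  obtain Lminus where minus: "\<And>E. has_lower_lyapunov_minus tw.sky tw.step sampling E (Lminus E)"
    using exists(2) by metis
  obtain \<phi> :: "(nat \<Rightarrow> bool) \<times> nat \<Rightarrow> real" where \<phi>: "inj \<phi>"
    using ex_inj_cantor_nat_real by blast
  let ?\<Omega> = "embed_measure tw.sky \<phi>" and ?f = "\<lambda>y. sampling (inv \<phi> y)"
  show ?thesis
  proof (intro exI conjI allI impI)
    show "sigma_finite_measure ?\<Omega>"
      by (rule sigma_finite_embed_measure[OF tw.sigma_finite_sky \<phi>])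
    show "emeasure ?\<Omega> (space ?\<Omega>) = \<infinity>"
      using infinite_sky by (simp add: space_embed_measure emeasure_embed_measure_image[OF \<phi>])
    show "conservative_transformation ?\<Omega> (transported tw.step \<phi>)"
      by (rule conservative_transport[OF \<phi> tw.conservative_step])
    show "invertible_transformation ?\<Omega> (transported tw.step \<phi>)"
      by (rule invertible_transport[OF \<phi> tw.invertible_step])
    show "measure_preserving_transformation ?\<Omega> (transported tw.step \<phi>)"
      by (rule measure_preserving_transport[OF \<phi> tw.measure_preserving_step])
    show "ergodic_transformation ?\<Omega> (transported tw.step \<phi>)"
      by (rule ergodic_transport[OF \<phi> tw.ergodic_step])
    show "?f \<in> borel_measurable ?\<Omega>"
      by (rule measurable_embed_measure1) (simp add: inv_f_f[OF \<phi>] sampling_measurable)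
    show "bounded (?f ` space ?\<Omega>)"
      by (rule finite_imp_bounded[OF finite_subset[OF image_subsetI[OF sampling_values]]]) simp
    show "(100::real) > 0" by simp
    show "has_lower_lyapunov_plus ?\<Omega> (transported tw.step \<phi>) ?f E (Lplus E)" for E
      by (rule has_lower_lyapunov_plus_transport[OF \<phi> plus])
    show "has_lower_lyapunov_minus ?\<Omega> (transported tw.step \<phi>) ?f E (Lminus E)" for E
      by (rule has_lower_lyapunov_minus_transport[OF \<phi> tw.invertible_step minus])
    show "Lplus E > Lminus E" if "E > 100" for E
      by (rule lower_lyapunov_large_energy[OF that plus minus])
    show "Lplus E < Lminus E" if "E < - 100" for E
      by (rule lower_lyapunov_small_energy[OF that plus minus])
  qed
qed

end
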